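(* Fix $L>0$ and $h>0$. There exists $\beta_0>0$ such that for every $\beta\in(0,\beta_0)$ the following holds. Let $F:X\to X$ be the billiard map of the Boltzmann billiard with potential $V_\beta$, wall $\ell$ and energy $h$, where $X$ is the set of initial conditions $(p,v)\in\ell\times\mathbb{R}^2$ with $v\cdot(0,1)>0$ for which $F$ is well defined. Then there exists a subset $X'\subset X$, invariant under $F$, such that $F|_{X'}$ is semi-conjugated to the Bernoulli shift $\sigma$ on $\Omega=(\mathbb{Z}\setminus\{0\})^{\mathbb{Z}}$; that is, there is a continuous surjective map $\pi:X'\to\Omega$ with $\sigma\circ\pi=\pi\circ F$ on $X'$.
   Context: Let $V_\beta:\mathbb{R}^2\setminus\{0\}\to\mathbb{R}$, $V_\beta(z)=-\frac{1}{|z|}-\frac{\beta}{|z|^2}$, with $\beta>0$. The reflecting wall is the line $\ell=\{(x,y):y=-L\}$, and $\mathcal P=\{(x,y):y>-L\}$ is the half-plane containing the origin. A billiard trajectory at energy $h$ is a motion in $\mathcal P$ solving $\ddot z=-\nabla V_\beta(z)$ with $\frac12|\dot z|^2+V_\beta(z)=h$, which, upon reaching $\ell$, is elastically reflected (the component of the velocity orthogonal to $\ell$ changes sign, the tangential component is preserved). The billiard map $F$ sends $(p,v)$ (a point of $\ell$ and an inward velocity at energy $h$) to the next point of $\ell$ hit by the trajectory together with the reflected velocity. $\Omega=(\mathbb{Z}\setminus\{0\})^{\mathbb{Z}}$ is the set of bi-infinite sequences of nonzero integers, with the metric $d(s,\bar s)=\sum_{i\in\mathbb{Z}}\delta(s_i,\bar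 s_i)\lambda^{-|i|}$ for a fixed $\lambda>3$, where $\delta(i,j)=0$ if $i=j$ and $1$ otherwise; the Bernoulli shift is $\sigma((s_i)_i)=(s_{i+1})_i$. *)

theory Defs
  imports "HOL-Analysis.Analysis"
begin

text \<open>The plane R^2 is identified with the complex numbers: (x,y) = x + i y.\<close>

definition V :: "real \<Rightarrow> complex \<Rightarrow> real" where
  "V \<beta> z = - 1 / cmod z - \<beta> / (cmod z)^2"

text \<open>The force field -grad V_beta(z) = -(1/|z|^3 + 2 beta/|z|^4) z, for z \<noteq> 0.\<close>
definition force :: "real \<Rightarrow> complex \<Rightarrow> complex" where
  "force \<beta> z = - of_real (1 / (cmod z)^3 + 2 * \<beta> / (cmod z)^4) * z"

definition reflect :: "complex \<Rightarrow> complex" where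
  "reflect w = Complex (Re w) (- Im w)"

definition arc :: "real \<Rightarrow> real \<Rightarrow> complex \<Rightarrow> complex \<Rightarrow> real \<Rightarrow>
    (real \<Rightarrow> complex) \<Rightarrow> (real \<Rightarrow> complex) \<Rightarrow> bool" where
  "arc \<beta> L p v T z z' \<longleftrightarrow>
     0 < T \<and> z 0 = p \<and> z' 0 = v \<and>
     (\<forall>t\<in>{0..T}. z t \<noteq> 0 \<and>
        (z has_vector_derivative z' t) (at t within {0..T}) \<and>
        (z' has_vector_derivative force \<beta> (z t)) (at t within {0..T})) \<and>
     (\<forall>t\<in>{0<..<T}. Im (z t) > - L) \<and> Im (z T) = - L"

definition billiard_domain :: "real \<Rightarrow> real \<Rightarrow> real \<Rightarrow> (complex \<times> complex) set" where
  "billiard_domain \<beta> L h = {(p, v). Im p = - L \<and> Im v > 0 \<and>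
      (cmod v)^2 / 2 + V \<beta> p = h \<and> (\<exists>T z z'. arc \<beta> L p v T z z')}"

definition billiard_map :: "real \<Rightarrow> real \<Rightarrow> complex \<times> complex \<Rightarrow> complex \<times> complex" where
  "billiard_map \<beta> L = (\<lambda>(p, v). SOME (q, w). \<exists>T z z'. arc \<beta> L p v T z z' \<and>
      q = z T \<and> w = reflect (z' T))"

definition Omega :: "(int \<Rightarrow> int) set" where
  "Omega = {s. \<forall>i. s i \<noteq> 0}"

definition omega_dist :: "real \<Rightarrow> (int \<Rightarrow> int) \<Rightarrow> (int \<Rightarrow> int) \<Rightarrow> real" where
  "omega_dist lam s s' = infsum (\<lambda>i. (if s i = s' i then 0 else 1) * lam powr (- real_of_int \<bar>i\<bar>)) UNIV"

definition shift :: "(int \<Rightarrow> int) \<Rightarrow> (int \<Rightarrow> int)" where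
  "shift s = (\<lambda>i. s (i + 1))"

end

theory Submission
  imports Defs
begin

text \<open>
  Write a bounce point as \<open>(L tan \<theta>, -L)\<close> and let \<open>c\<close> be the angular momentum of the arc leaving it.
  With \<open>P = c\<^sup>2 - 2\<beta> > 0\<close>, an arc is a Kepler conic whose polar angle is stretched by \<open>c / sqrt P\<close>,
  so the angle swept between the pericenter and the wall is an explicit function \<open>g c \<theta>\<close>. An arc
  from \<open>\<theta>\<close> to \<open>\<theta>'\<close> winding \<open>k\<close> times around the origin satisfies
  \<open>g c \<theta> + g c \<theta>' + \<theta> - \<theta>' = 2 \<pi> k\<close>; as \<open>P\<close> tends to 0 the left-hand side tends to infinity, which
  makes every \<open>k \<noteq> 0\<close> available. The reflection law reads \<open>a' - a = 2 \<theta>\<close>, where \<open>a\<close> and \<open>a'\<close> are the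
  angles between the velocity and the radius before and after the bounce.
  For a prescribed sequence \<open>k\<close> these equations form a monotone system once the signs of every
  second \<open>\<theta>\<close> are flipped, so a bi-infinite solution exists by the Knaster--Tarski argument. Since
  \<open>g c\<close> is a contraction in \<open>\<theta>\<close>, the sequence \<open>k\<close> depends continuously on \<open>(\<theta> 0, c 0)\<close>.
\<close>

section \<open>Uniqueness of arcs\<close>

text \<open>In terms of the reciprocal radii \<open>x\<close> and \<open>y\<close>, the difference
  of the scalar coefficients contains the factor \<open>x - y = (cmod w - cmod z) * (x * y)\<close>.
  Its factor \<open>y\<close> cancels \<open>cmod w\<close>, so the constant depends only on the
  distance \<open>m\<close> from the origin, not on the size of \<open>z\<close> and
  \<open>w\<close>.\<close>

lemma force_lipschitz:
  assumes m: "m > 0" "m \<le> cmod z" "m \<le> cmod w" and b: "\<beta> \<ge> 0"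
  shows "cmod (force \<beta> z - force \<beta> w) \<le> (4 / m^3 + 10 * \<beta> / m^4) * cmod (z - w)"
proof -
  define x y u where "x = 1 / cmod z" and "y = 1 / cmod w" and "u = 1 / m"
  have pos: "cmod z > 0" "cmod w > 0" using m by auto
  have xy: "0 < x" "x \<le> u" "0 < y" "y \<le> u" using m pos by (auto simp: x_def y_def u_def field_simps)
  have yw: "y * cmod w = 1" using pos by (simp add: y_def)
  have xmy: "x - y = (cmod w - cmod z) * (x * y)" using pos by (simp add: x_def y_def field_simps)
  have tri: "\<bar>cmod w - cmod z\<bar> \<le> cmod (z - w)"
    by (metis norm_minus_commute norm_triangle_ineq3)
  have fz: "force \<beta> z = - of_real (x^3 + 2 * \<beta> * x^4) * z"
    if "x = 1 / cmod z" for z x using that by (simp add: force_def power_divide)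
  have e: "force \<beta> z - force \<beta> w =
      - (of_real (x^3 + 2 * \<beta> * x^4) * (z - w) + of_real ((x^3 - y^3) + 2 * \<beta> * (x^4 - y^4)) * w)"
    unfolding fz[OF x_def] fz[OF y_def] by (simp add: algebra_simps)
  have d: "((x^3 - y^3) + 2 * \<beta> * (x^4 - y^4)) * cmod w
      = (cmod w - cmod z) * (x * (x^2 + x*y + y^2) + 2 * \<beta> * (x * (x^3 + x^2*y + x*y^2 + y^3)))"
  proof -
    have "((x^3 - y^3) + 2 * \<beta> * (x^4 - y^4)) = (x - y) * ((x^2 + x*y + y^2) + 2 * \<beta> * (x^3 + x^2*y + x*y^2 + y^3))"
      by (simp add: power_def algebra_simps numeral_eq_Suc)
    also have "\<dots> = (cmod w - cmod z) * x * y * ((x^2 + x*y + y^2) + 2 * \<beta> * (x^3 + x^2*y + x*y^2 + y^3))"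
      by (simp add: xmy)
    finally have "((x^3 - y^3) + 2 * \<beta> * (x^4 - y^4)) * cmod w
      = (cmod w - cmod z) * x * (y * cmod w) * ((x^2 + x*y + y^2) + 2 * \<beta> * (x^3 + x^2*y + x*y^2 + y^3))"
      by simp
    then show ?thesis unfolding yw by (simp add: algebra_simps)
  qed
  have p: "x^i * y^j \<le> u^(i+j)" for i j
    using xy by (auto simp: power_add intro!: mult_mono power_mono)
  have s3: "x * (x^2 + x*y + y^2) \<le> 3 * u^3"
    using p[of 3 0] p[of 2 1] p[of 1 2] by (simp add: algebra_simps power2_eq_square power3_eq_cube)
  have s4: "x * (x^3 + x^2*y + x*y^2 + y^3) \<le> 4 * u^4"
    using p[of 4 0] p[of 3 1] p[of 2 2] p[of 1 3]
    by (simp add: algebra_simps power2_eq_square power3_eq_cube power4_eq_xxxx)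
  have s0: "0 \<le> x * (x^2 + x*y + y^2)" "0 \<le> x * (x^3 + x^2*y + x*y^2 + y^3)" using xy by auto
  have A: "cmod (of_real ((x^3 - y^3) + 2 * \<beta> * (x^4 - y^4)) * w) \<le> cmod (z - w) * (3 * u^3 + 2 * \<beta> * (4 * u^4))"
  proof -
    have "cmod (of_real ((x^3 - y^3) + 2 * \<beta> * (x^4 - y^4)) * w)
        = \<bar>((x^3 - y^3) + 2 * \<beta> * (x^4 - y^4)) * cmod w\<bar>" 
      by (simp only: norm_mult norm_of_real abs_mult) simp
    also have "\<dots> = \<bar>cmod w - cmod z\<bar> * (x * (x^2 + x*y + y^2) + 2 * \<beta> * (x * (x^3 + x^2*y + x*y^2 + y^3)))"
      unfolding d abs_mult using s0 b by simp
    also have "\<dots> \<le> cmod (z - w) * (3 * u^3 + 2 * \<beta> * (4 * u^4))"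
      by (intro mult_mono add_mono mult_left_mono s3 s4 tri) (use b s0 in auto)
    finally show ?thesis .
  qed
  have B: "cmod (of_real (x^3 + 2 * \<beta> * x^4) * (z - w)) \<le> (u^3 + 2 * \<beta> * u^4) * cmod (z - w)"
  proof -
    have "\<bar>x^3 + 2 * \<beta> * x^4\<bar> \<le> u^3 + 2 * \<beta> * u^4"
      using xy b by (auto simp: abs_of_nonneg intro!: add_mono mult_left_mono power_mono)
    then show ?thesis unfolding norm_mult norm_of_real by (intro mult_right_mono) auto
  qed
  have "cmod (force \<beta> z - force \<beta> w) \<le> (u^3 + 2 * \<beta> * u^4) * cmod (z - w) + cmod (z - w) * (3 * u^3 + 2 * \<beta> * (4 * u^4))"
    unfolding e norm_minus_cancel by (rule order_trans[OF norm_triangle_ineq add_mono[OF B A]])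
  also have "\<dots> = (4 / m^3 + 10 * \<beta> / m^4) * cmod (z - w)"
    by (simp add: u_def power_divide algebra_simps)
  finally show ?thesis .
qed

definition solves :: "real \<Rightarrow> real \<Rightarrow> (real \<Rightarrow> complex) \<Rightarrow> (real \<Rightarrow> complex) \<Rightarrow> bool" where
  "solves \<beta> T z z' \<longleftrightarrow> (\<forall>t\<in>{0..T}. z t \<noteq> 0 \<and>
        (z has_vector_derivative z' t) (at t within {0..T}) \<and>
        (z' has_vector_derivative force \<beta> (z t)) (at t within {0..T}))"

lemma solves_subset: "solves \<beta> T z z' \<Longrightarrow> S \<le> T \<Longrightarrow> solves \<beta> S z z'"
  unfolding solves_def
  by (meson atLeastAtMost_iff atLeastatMost_subset_iff has_vector_derivative_within_subset order_refl order_trans)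

lemma solves_bounded_below:
  assumes "solves \<beta> T z z'" "0 \<le> T"
  shows "\<exists>m>0. \<forall>t\<in>{0..T}. m \<le> cmod (z t)"
proof -
  have "continuous_on {0..T} z"
    using assms unfolding solves_def by (meson continuous_on_vector_derivative)
  then have "continuous_on {0..T} (\<lambda>t. cmod (z t))" by (intro continuous_intros)
  then obtain t0 where "t0 \<in> {0..T}" "\<forall>t\<in>{0..T}. cmod (z t0) \<le> cmod (z t)"
    using continuous_attains_inf[of "{0..T}" "\<lambda>t. cmod (z t)"] assms(2) by auto
  then show ?thesis using assms(1) unfolding solves_def by (intro exI[of _ "cmod (z t0)"]) auto
qed

text \<open>Gronwall's argument for the squared distance in phase space.\<close>

lemma solves_unique:
  assumes b: "\<beta> \<ge> 0" and z: "solves \<beta> T z z'" and w: "solves \<beta> T w w'"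
    and init: "z 0 = w 0" "z' 0 = w' 0" and t: "t \<in> {0..T}"
  shows "z t = w t \<and> z' t = w' t"
proof -
  have T: "0 \<le> T" using t by auto
  obtain m1 where m1: "m1 > 0" "\<forall>t\<in>{0..T}. m1 \<le> cmod (z t)" using solves_bounded_below[OF z T] by auto
  obtain m2 where m2: "m2 > 0" "\<forall>t\<in>{0..T}. m2 \<le> cmod (w t)" using solves_bounded_below[OF w T] by auto
  define m where "m = min m1 m2"
  have m: "m > 0" "\<And>t. t\<in>{0..T} \<Longrightarrow> m \<le> cmod (z t)" "\<And>t. t\<in>{0..T} \<Longrightarrow> m \<le> cmod (w t)"
    using m1 m2 by (auto simp: m_def min.coboundedI1 min.coboundedI2)
  define K where "K = 4 / m^3 + 10 * \<beta> / m^4"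
  have K: "K \<ge> 0" using m(1) b by (simp add: K_def)
  define D where "D = (\<lambda>t. (z t - w t) \<bullet> (z t - w t) + (z' t - w' t) \<bullet> (z' t - w' t))"
  define E where "E = (\<lambda>t. exp (- (1 + K) * t) * D t)"
  define D' where "D' = (\<lambda>t. 2 * ((z t - w t) \<bullet> (z' t - w' t)) + 2 * ((z' t - w' t) \<bullet> (force \<beta> (z t) - force \<beta> (w t))))"
  have dD: "(D has_vector_derivative D' t) (at t within {0..T})" if "t \<in> {0..T}" for t
  proof -
    have d: "((\<lambda>t. z t - w t) has_vector_derivative (z' t - w' t)) (at t within {0..T})"
         "((\<lambda>t. z' t - w' t) has_vector_derivative (force \<beta> (z t) - force \<beta> (w t))) (at t within {0..T})"
      using z w that unfolding solves_def by (auto intro!: has_vector_derivative_diff)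
    have sq: "((\<lambda>t. u t \<bullet> u t) has_vector_derivative 2 * (u t \<bullet> u')) (at t within {0..T})"
      if "(u has_vector_derivative u') (at t within {0..T})" for u u'
      using has_derivative_inner[OF that[unfolded has_vector_derivative_def] that[unfolded has_vector_derivative_def]]
      unfolding has_vector_derivative_def
      by (rule has_derivative_eq_rhs) (auto simp: inner_commute algebra_simps)
    show ?thesis unfolding D_def D'_def
      by (intro has_vector_derivative_add sq d)
  qed
  have dE: "(E has_vector_derivative (exp (- (1 + K) * t) * (D' t - (1 + K) * D t))) (at t within {0..T})" if "t \<in> {0..T}" for t
  proof -
    have "(D has_real_derivative D' t) (at t within {0..T})" using dD[OF that]
      by (simp add: has_real_derivative_iff_has_vector_derivative)
    then have "(E has_real_derivative (exp (- (1 + K) * t) * (D' t - (1 + K) * D t))) (at t within {0..T})"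
      unfolding E_def by (auto intro!: derivative_eq_intros simp: algebra_simps)
    then show ?thesis by (simp add: has_real_derivative_iff_has_vector_derivative)
  qed
  \<comment> \<open>Cauchy-Schwarz bounds the inner products by \<open>p * q\<close> and
    \<open>q * (K * p)\<close>. Then \<open>2 * (p * q) \<le> p^2 + q^2\<close> gives the growth
    rate \<open>1 + K\<close>, which the weight in \<open>E\<close> cancels.\<close>
  have D': "D' t \<le> (1 + K) * D t" if "t \<in> {0..T}" for t
  proof -
    define p q where "p = cmod (z t - w t)" and "q = cmod (z' t - w' t)"
    have "2 * ((z t - w t) \<bullet> (z' t - w' t)) \<le> 2 * (p * q)"
      unfolding p_def q_def using norm_cauchy_schwarz by auto
    moreover have "(z' t - w' t) \<bullet> (force \<beta> (z t) - force \<beta> (w t)) \<le> q * (K * p)"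
      unfolding p_def q_def K_def
      by (rule order_trans[OF norm_cauchy_schwarz])
        (intro mult_left_mono force_lipschitz m that b, auto)
    moreover have "2 * (p * q) \<le> p^2 + q^2" using sum_squares_bound[of p q] by (simp add: algebra_simps)
    moreover from this have "K * (2 * (p * q)) \<le> K * (p^2 + q^2)" using K by (rule mult_left_mono)
    moreover have "D t = p^2 + q^2" unfolding D_def p_def q_def by (simp add: power2_norm_eq_inner)
    ultimately show ?thesis unfolding D'_def by (simp add: algebra_simps)
  qed
  have "E t \<le> E 0"
  proof (cases "t = 0")
    case False
    then have t0: "0 < t" using t by auto
    have cont: "continuous_on {0..T} E" by (rule continuous_on_vector_derivative, erule dE)
    show ?thesis
    proof (rule DERIV_nonpos_imp_decreasing_open[of 0 t E])
      show "continuous_on {0..t} E" using cont t by (auto intro: continuous_on_subset)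
      fix x assume x: "0 < x" "x < t"
      have "(E has_vector_derivative (exp (- (1 + K) * x) * (D' x - (1 + K) * D x))) (at x)"
        using dE[of x] x t by (simp add: at_within_Icc_at)
      moreover have "exp (- (1 + K) * x) * (D' x - (1 + K) * D x) \<le> 0"
        using D'[of x] x t by (intro mult_nonneg_nonpos) auto
      ultimately show "\<exists>y. (E has_real_derivative y) (at x) \<and> y \<le> 0"
        by (auto simp: has_real_derivative_iff_has_vector_derivative)
    qed (use t0 in auto)
  qed auto
  also have "E 0 = 0" by (simp add: E_def D_def init)
  finally have "D t \<le> 0" by (simp add: E_def mult_le_0_iff)
  moreover have "(z t - w t) \<bullet> (z t - w t) \<ge> 0" "(z' t - w' t) \<bullet> (z' t - w' t) \<ge> 0" by auto
  ultimately have "(z t - w t) \<bullet> (z t - w t) = 0" "(z' t - w' t) \<bullet> (z' t - w' t) = 0"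
    unfolding D_def by linarith+
  then show ?thesis by simp
qed

lemma arc_solves: "arc \<beta> L p v T z z' \<Longrightarrow> solves \<beta> T z z'"
  by (auto simp: arc_def solves_def)

text \<open>Both arcs follow the same solution up to time \<open>T\<close>. There the solution is on
  the wall, which the longer arc may touch only at its end time.\<close>

lemma arc_unique_le:
  assumes b: "\<beta> \<ge> 0" and A: "arc \<beta> L p v T z z'" "arc \<beta> L p v S w w'" and le: "T \<le> S"
  shows "z T = w S \<and> z' T = w' S"
proof -
  have eq: "z t = w t \<and> z' t = w' t" if "t \<in> {0..T}" for t
    using solves_unique[OF b arc_solves[OF A(1)] solves_subset[OF arc_solves[OF A(2)] le] _ _ that] A
    by (auto simp: arc_def)
  have "T > 0" using A by (auto simp: arc_def)
  moreover have "Im (w T) = - L" using eq[of T] A(1) \<open>T > 0\<close> by (auto simp: arc_def)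
  ultimately have "T = S" using A(2) le unfolding arc_def by (metis greaterThanLessThan_iff order_less_irrefl order_le_less)
  then show ?thesis using eq[of T] \<open>T > 0\<close> by auto
qed

text \<open>All arcs from one initial state end alike, whichever of two lasts longer, so the choice
  operator in \<open>billiard_map\<close> has a single candidate.\<close>

lemma billiard_map_eq:
  assumes b: "\<beta> \<ge> 0" and A: "arc \<beta> L p v T z z'"
  shows "billiard_map \<beta> L (p, v) = (z T, reflect (z' T))"
proof -
  have "\<exists>qw. case qw of (q, w) \<Rightarrow> \<exists>T z z'. arc \<beta> L p v T z z' \<and> q = z T \<and> w = reflect (z' T)"
    using A by auto
  from someI_ex[OF this] obtain S w w' where
    "arc \<beta> L p v S w w'" "billiard_map \<beta> L (p, v) = (w S, reflect (w' S))"
    unfolding billiard_map_def by (auto split: prod.splits)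
  then show ?thesis using arc_unique_le[OF b A, of S w w'] arc_unique_le[OF b _ A, of S w w']
    by (metis linear)
qed

section \<open>Auxiliary analysis\<close>

lemma summable_lam_powr:
  assumes "lam > (1::real)"
  shows "(\<lambda>i::int. lam powr (- real_of_int \<bar>i\<bar>)) summable_on UNIV"
proof -
  have g: "(\<lambda>n::nat. lam powr (- real n)) summable_on UNIV"
  proof -
    have "summable (\<lambda>n::nat. (1 / lam) ^ n)" using assms by (intro summable_geometric) auto
    also have "(\<lambda>n::nat. (1 / lam) ^ n) = (\<lambda>n. lam powr (- real n))"
      using assms by (auto simp: powr_minus powr_realpow power_divide divide_simps)
    finally show ?thesis by (intro norm_summable_imp_summable_on) auto
  qed
  have 1: "(\<lambda>i::int. lam powr (- real_of_int \<bar>i\<bar>)) summable_on range int"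
    using g by (subst summable_on_reindex) (auto simp: o_def)
  have 2: "(\<lambda>i::int. lam powr (- real_of_int \<bar>i\<bar>)) summable_on range (\<lambda>n. - int n)"
    using g by (subst summable_on_reindex) (auto simp: o_def inj_on_def)
  have "range int \<union> range (\<lambda>n. - int n) = UNIV"
    by (metis (no_types) UNIV_eq_I UnCI int_cases2 rangeI)
  then show ?thesis using summable_on_union[OF 1 2] by simp
qed

text \<open>The weights are summable, so those outside a finite window have total below
  \<open>\<epsilon>\<close>. This reduces continuity into the sequence space to eventual equality of
  each entry.\<close>

lemma omega_dist_small:
  assumes "lam > 1" "\<epsilon> > 0"
  shows "\<exists>N. \<forall>s s'. (\<forall>i. \<bar>i\<bar> \<le> N \<longrightarrow> s i = s' i) \<longrightarrow> omega_dist lam s s' < \<epsilon>"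
proof -
  let ?f = "\<lambda>i::int. lam powr (- real_of_int \<bar>i\<bar>)"
  have "(?f has_sum infsum ?f UNIV) UNIV" using summable_lam_powr[OF assms(1)] by (rule has_sum_infsum)
  then have "\<forall>\<^sub>F F in finite_subsets_at_top UNIV. dist (sum ?f F) (infsum ?f UNIV) < \<epsilon>"
    unfolding has_sum_def using assms(2) by (rule tendstoD)
  then obtain F where F: "finite F" "dist (sum ?f F) (infsum ?f UNIV) < \<epsilon>"
    unfolding eventually_finite_subsets_at_top by blast
  define N where "N = Max (insert 0 (abs ` F))"
  have N: "\<bar>i\<bar> \<le> N" if "i \<in> F" for i using that F(1) unfolding N_def by (intro Max_ge) auto
  have split: "infsum ?f UNIV = sum ?f F + infsum ?f (- F)"
  proof -
    have "infsum ?f (F \<union> - F) = infsum ?f F + infsum ?f (- F)"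
      using summable_on_subset[OF summable_lam_powr[OF assms(1)]] by (intro infsum_Un_disjoint) auto
    then show ?thesis using F(1) by simp
  qed
  show ?thesis
  proof (intro exI[of _ N] allI impI)
    fix s s' :: "int \<Rightarrow> int" assume eq: "\<forall>i. \<bar>i\<bar> \<le> N \<longrightarrow> s i = s' i"
    let ?g = "\<lambda>i. (if s i = s' i then 0 else 1) * ?f i"
    have gs: "?g summable_on UNIV"
      using summable_lam_powr[OF assms(1)] by (rule summable_on_comparison_test) auto
    have "omega_dist lam s s' = infsum ?g (- F)" unfolding omega_dist_def
      by (rule infsum_cong_neutral) (use N eq in auto)
    also have "\<dots> \<le> infsum ?f (- F)"
      using summable_on_subset[OF summable_lam_powr[OF assms(1)]] summable_on_subset[OF gs]
      by (intro infsum_mono) auto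
    also have "\<dots> < \<epsilon>" using F(2) split by (simp add: dist_real_def)
    finally show "omega_dist lam s s' < \<epsilon>" .
  qed
qed

text \<open>Knaster--Tarski: the pointwise supremum \<open>u\<close> of all points with
  \<open>x \<le> M x\<close> is itself such a point. Working with order alone suits maps built from
  largest roots, which may jump.\<close>

lemma monotone_box_fixpoint:
  fixes M :: "('a \<Rightarrow> real) \<Rightarrow> 'a \<Rightarrow> real"
  assumes box: "\<And>x i. (\<And>i. x i \<in> {a..b}) \<Longrightarrow> M x i \<in> {a..b}"
    and mono: "\<And>x y i. (\<And>i. x i \<in> {a..b}) \<Longrightarrow> (\<And>i. y i \<in> {a..b}) \<Longrightarrow> (\<And>i. x i \<le> y i) \<Longrightarrow> M x i \<le> M y i"
    and ab: "a \<le> b"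
  shows "\<exists>x. (\<forall>i. x i \<in> {a..b}) \<and> (\<forall>i. M x i = x i)"
proof -
  define S where "S = {x. (\<forall>i. x i \<in> {a..b}) \<and> (\<forall>i. x i \<le> M x i)}"
  define u where "u = (\<lambda>i. SUP x\<in>S. x i)"
  have bdd: "bdd_above ((\<lambda>x. x i) ` S)" for i by (auto simp: S_def intro!: bdd_aboveI[of _ b])
  have up: "x i \<le> u i" if "x \<in> S" for x i unfolding u_def using that bdd by (intro cSUP_upper)
  have aS: "(\<lambda>_. a) \<in> S" using box[of "\<lambda>_. a"] ab by (auto simp: S_def)
  have lub: "u i \<le> y" if "\<And>x. x \<in> S \<Longrightarrow> x i \<le> y" for i y
    unfolding u_def using aS that by (intro cSUP_least) auto
  have ubox: "u i \<in> {a..b}" for i using up[OF aS] lub[of i b] by (auto simp: S_def)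
  have 1: "u i \<le> M u i" for i
  proof (rule lub)
    fix x assume x: "x \<in> S"
    then have "x i \<le> M x i" by (auto simp: S_def)
    also have "\<dots> \<le> M u i" using x up[OF x] ubox by (intro mono) (auto simp: S_def)
    finally show "x i \<le> M u i" .
  qed
  \<comment> \<open>Monotonicity carries \<open>u \<le> M u\<close> over to \<open>M u\<close>, so
    \<open>M u\<close> competes in the supremum and lies below \<open>u\<close>.\<close>
  have "M u \<in> S" using 1 ubox box[of u] by (auto simp: S_def intro!: mono)
  then have "M u i \<le> u i" for i by (rule up)
  then show ?thesis using 1 ubox by (intro exI[of _ u]) (auto simp: order_antisym)
qed

text \<open>A supremum of a set where \<open>f\<close> is nonnegative grows with \<open>f\<close>;
  this makes the chosen root monotone in parameters. Points of \<open>D\<close> below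
  \<open>a\<close> do not affect the supremum because \<open>a\<close> itself is in the set. If
  \<open>f\<close> were positive at the supremum, the intermediate value theorem would give a root
  further right.\<close>

lemma Sup_root:
  fixes f :: "real \<Rightarrow> real"
  assumes cont: "continuous_on {a..b} f" and ab: "a \<le> b" and f: "f a \<ge> 0" "f b \<le> 0"
    and D: "{a..b} \<subseteq> D" "D \<subseteq> {..b}"
  shows "Sup {x\<in>D. f x \<ge> 0} \<in> {a..b}" "f (Sup {x\<in>D. f x \<ge> 0}) = 0"
proof -
  define S where "S = {x\<in>D. f x \<ge> 0}"
  define S' where "S' = {a..b} \<inter> f -` {0..}"
  have aS: "a \<in> S" "a \<in> S'" using D f ab by (auto simp: S_def S'_def)
  have bd: "bdd_above S" using D by (auto simp: S_def intro!: bdd_aboveI[of _ b])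
  have "closed S'" unfolding S'_def using cont by (intro continuous_closed_preimage) auto
  moreover have bd': "bdd_above S'" by (auto simp: S'_def intro!: bdd_aboveI[of _ b])
  ultimately have sS': "Sup S' \<in> S'" using aS by (intro closed_contains_Sup) auto
  have "Sup S = Sup S'"
  proof (rule cSup_eq_maximum)
    show "Sup S' \<in> S" using sS' D by (auto simp: S_def S'_def)
    fix x assume x: "x \<in> S"
    show "x \<le> Sup S'"
    proof (cases "x \<ge> a")
      case True then have "x \<in> S'" using x D by (auto simp: S_def S'_def)
      then show ?thesis using bd' by (rule cSup_upper)
    next
      case False then show ?thesis using cSup_upper[OF aS(2) bd'] by auto
    qed
  qed
  then have s: "Sup S \<in> {a..b}" "f (Sup S) \<ge> 0" using sS' by (auto simp: S'_def)
  have "f (Sup S) \<le> 0"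
  proof (rule ccontr)
    assume n: "\<not> ?thesis"
    obtain x where x: "x \<ge> Sup S" "x \<le> b" "f x = 0"
      using IVT2'[of f b 0 "Sup S"] n f s continuous_on_subset[OF cont, of "{Sup S..b}"] by auto
    then have "x \<in> S" using D s by (auto simp: S_def)
    then have "x \<le> Sup S" using bd by (rule cSup_upper)
    then show False using x n by auto
  qed
  then show "Sup {x\<in>D. f x \<ge> 0} \<in> {a..b}" "f (Sup {x\<in>D. f x \<ge> 0}) = 0" using s by (auto simp: S_def)
qed

text \<open>Separation of variables: \<open>f\<close> is the inverse of a primitive of \<open>q\<close>.\<close>

lemma autonomous_solution:
  fixes q :: "real \<Rightarrow> real"
  assumes AB: "A < B" and cont: "continuous_on {A..B} q" and pos: "\<And>x. x \<in> {A..B} \<Longrightarrow> q x > 0"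
  shows "\<exists>T f. 0 < T \<and> f 0 = A \<and> f T = B \<and> (\<forall>t\<in>{0<..<T}. A < f t \<and> f t < B) \<and>
    (\<forall>t\<in>{0..T}. (f has_real_derivative 1 / q (f t)) (at t))"
proof -
  \<comment> \<open>Clamping extends \<open>q\<close> past the ends, so that the primitive has
    two-sided derivatives at \<open>A\<close> and \<open>B\<close> as well.\<close>
  define q' where "q' = (\<lambda>x. q (max A (min B x)))"
  have q': "q' x = q x" if "x \<in> {A..B}" for x using that by (auto simp: q'_def max_def min_def)
  have qpos: "q' x > 0" for x unfolding q'_def using AB by (intro pos) auto
  have qc: "continuous_on UNIV q'" unfolding q'_def
    using AB by (intro continuous_on_compose2[OF cont]) (auto intro!: continuous_intros)
  have "\<exists>W. \<forall>x\<in>{A-1..B+1}. (W has_real_derivative q' x) (at x within {A-1..B+1})"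
    using antiderivative_continuous[OF continuous_on_subset[OF qc subset_UNIV], of "A-1" "B+1"]
    by (metis has_real_derivative_iff_has_vector_derivative)
  then obtain W where W: "\<And>x. x\<in>{A-1..B+1} \<Longrightarrow> (W has_real_derivative q' x) (at x within {A-1..B+1})" by blast
  \<comment> \<open>Normalised to vanish at \<open>A\<close>, \<open>W0 x\<close> is the time at
    which \<open>x\<close> is reached; the total time is \<open>W0 B\<close>.\<close>
  define W0 where "W0 x = W x - W A" for x
  have dV: "(W0 has_real_derivative q' x) (at x)" if "A - 1 < x" "x < B + 1" for x
    using W[of x] that unfolding W0_def by (auto intro!: derivative_eq_intros simp: at_within_Icc_at)
  have W0: "W0 x < W0 y" if "A - 1 < x" "x < y" "y < B + 1" for x y
  proof (rule DERIV_pos_imp_increasing[OF that(2)])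
    fix t assume "x \<le> t" "t \<le> y"
    then show "\<exists>d. (W0 has_real_derivative d) (at t) \<and> 0 < d"
      using that dV[of t] qpos[of t] by (intro exI[of _ "q' t"]) auto
  qed
  define I where "I = {A-1/2..B+1/2}"
  have contV: "continuous_on I W0" unfolding I_def
    by (rule DERIV_continuous_on, rule has_field_derivative_at_within, rule dV) auto
  define f where "f = inv_into I W0"
  have inj: "inj_on W0 I"
  proof (rule linorder_inj_onI')
    fix x y assume "x \<in> I" "y \<in> I" "x < y"
    then show "W0 x \<noteq> W0 y" using W0[of x y] by (auto simp: I_def)
  qed
  have fV: "f (W0 x) = x" if "x \<in> I" for x unfolding f_def using that inj by (rule inv_into_f_f[rotated])
  have VA: "W0 A = 0" by (simp add: W0_def)
  have lt: "W0 (A - 1/2) < 0" "W0 B < W0 (B + 1/2)" "0 < W0 B"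
    using W0[of "A-1/2" A] W0[of B "B+1/2"] W0[of A B] AB by (auto simp: VA)
  have img: "W0 ` I = {W0 (A-1/2)..W0 (B+1/2)}"
  proof (intro equalityI subsetI)
    fix y assume "y \<in> W0 ` I" then obtain x where x: "x \<in> I" "y = W0 x" by auto
    have "W0 (A-1/2) \<le> W0 x" using W0[of "A-1/2" x] x by (cases "x = A-1/2") (auto simp: I_def)
    moreover have "W0 x \<le> W0 (B+1/2)" using W0[of x "B+1/2"] x by (cases "x = B+1/2") (auto simp: I_def)
    ultimately show "y \<in> {W0 (A-1/2)..W0 (B+1/2)}" using x by auto
  next
    fix y assume "y \<in> {W0 (A-1/2)..W0 (B+1/2)}"
    then show "y \<in> W0 ` I" using IVT'[of W0 "A-1/2" y "B+1/2"] contV AB by (auto simp: I_def)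
  qed
  have Vf: "W0 (f y) = y" "f y \<in> I" if "W0 (A-1/2) \<le> y" "y \<le> W0 (B+1/2)" for y
    using that unfolding f_def by (auto intro!: f_inv_into_f inv_into_into simp: img)
  have contf: "continuous_on (W0 ` I) f"
    by (rule continuous_on_inv[OF contV]) (auto simp: fV I_def)
  have Vle: "x \<le> y" if "W0 x \<le> W0 y" "x \<in> I" "y \<in> I" for x y
  proof (rule ccontr)
    assume "\<not> x \<le> y"
    then show False using W0[of y x] that by (auto simp: I_def)
  qed
  have fAB: "f t \<in> {A..B}" if "t \<in> {0..W0 B}" for t
  proof -
    have "W0 (f t) = t" "f t \<in> I" using Vf[of t] that lt by auto
    then show ?thesis using Vle[of A "f t"] Vle[of "f t" B] that VA AB by (auto simp: I_def)
  qed
  have df: "(f has_real_derivative 1 / q (f t)) (at t)" if t: "t \<in> {0..W0 B}" for t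
  proof -
    have "(f has_real_derivative inverse (q' (f t))) (at t)"
    proof (rule DERIV_inverse_function[where f = W0 and a = "W0 (A-1/2)" and b = "W0 (B+1/2)"])
      show "(W0 has_real_derivative q' (f t)) (at (f t))" using fAB[OF t] by (intro dV) auto
      show "q' (f t) \<noteq> 0" using qpos[of "f t"] by auto
      show "W0 (A - 1/2) < t" "t < W0 (B + 1/2)" using t lt by auto
      show "isCont f t" using contf t lt unfolding img
        by (intro continuous_on_interior[OF contf[unfolded img]]) auto
    qed (use Vf in auto)
    then show ?thesis using q'[OF fAB[OF t]] by (simp add: divide_inverse)
  qed
  have fi: "A < f t \<and> f t < B" if "t \<in> {0<..<W0 B}" for t
  proof -
    have "W0 (f t) = t" using Vf[of t] that lt by auto
    then show ?thesis using fAB[of t] that VA by (auto simp: less_le)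
  qed
  have "f 0 = A" "f (W0 B) = B" using fV[of A] fV[of B] VA AB by (simp_all add: I_def)
  then show ?thesis using lt(3) fi df by blast
qed

section \<open>Swept angle and law of reflection\<close>

lemma cos_ge_quadratic: "1 - x^2 / 2 \<le> cos (x::real)"
proof -
  have "(sin (x/2))^2 \<le> (x/2)^2" using abs_sin_x_le_abs_x[of "x/2"] abs_le_square_iff by blast
  then show ?thesis using cos_double_sin[of "x/2"] by (simp add: power_divide)
qed

lemma cos_ge_small: "\<bar>x\<bar> \<le> 1/4 \<Longrightarrow> 31/32 \<le> cos (x::real)"
proof -
  assume "\<bar>x\<bar> \<le> 1/4"
  then have "x^2 \<le> (1/4)^2" using abs_le_square_iff[of x "1/4"] by simp
  then show ?thesis using cos_ge_quadratic[of x] by (simp add: power_divide)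
qed

text \<open>By the mean value theorem \<open>sin (1/4)\<close> is at least 31/128, which exceeds
  1/5.\<close>

lemma arcsin_small:
  assumes "\<bar>x\<bar> \<le> (1/5::real)" shows "\<bar>arcsin x\<bar> \<le> 1/4"
proof -
  have "\<exists>z>0. z < 1/4 \<and> sin (1/4) - sin 0 = (1/4 - 0) * cos (z::real)"
    by (rule MVT2) (auto intro!: derivative_eq_intros)
  then obtain z :: real where "z > 0" "z < 1/4" "sin (1/4) = 1/4 * cos z" by auto
  then have s: "sin (1/4::real) \<ge> 1/5" using cos_ge_small[of z] by auto
  have pi: "pi > 3" by (rule pi_gt3)
  have "arcsin x \<le> arcsin (sin (1/4))" using s assms by (intro arcsin_le_arcsin) auto
  moreover have "arcsin (sin (-1/4)) \<le> arcsin x" using s assms by (intro arcsin_le_arcsin) auto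
  moreover have "arcsin (sin (1/4)) = (1/4::real)" "arcsin (sin (-1/4)) = (-1/4::real)"
    using pi by (intro arcsin_sin; simp)+
  ultimately show ?thesis by linarith
qed

text \<open>\<open>Complex u v\<close> holds radial and transverse components in a frame turned by
  \<open>a\<close>; the rotation of the frame contributes the terms with \<open>a'\<close>. It
  serves both for position and for velocity.\<close>

lemma polar_derivative:
  assumes "(u has_real_derivative u') F" "(v has_real_derivative v') F" "(a has_real_derivative a') F"
    and F: "F = at t within S"
  shows "((\<lambda>t. Complex (u t) (v t) * cis (a t)) has_vector_derivative
    Complex (u' - v t * a') (v' + u t * a') * cis (a t)) F"
  using assms(1-3) unfolding has_vector_derivative_complex_iff F
  by (auto intro!: derivative_eq_intros simp: algebra_simps)

text \<open>Below \<open>L / 1600\<close>, \<open>2 * \<beta>\<close> is less than one fiftieth of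
  \<open>L / 16\<close>. So at the top of the admissible range the polar angle is stretched by at
  most 99/98.\<close>

locale boltzmann =
  fixes L h \<beta> :: real
  assumes L: "0 < L" and h: "0 < h" and \<beta>: "0 < \<beta>" "\<beta> < L / 1600"
begin

text \<open>The box \<open>\<bar>\<theta>\<bar> \<le> 1/4\<close>, \<open>c\<^sup>2 \<le> L/16\<close> traps the dynamics: a velocity with such a \<open>c\<close> deviates from the
  radius by less than \<open>1/4\<close>, and at \<open>c\<^sup>2 = L/16\<close> the sweep is too small for a full turn.\<close>

definition adm :: "real \<Rightarrow> bool" where "adm c \<longleftrightarrow> 2 * \<beta> < c^2 \<and> c^2 \<le> L / 16"
text \<open>The eccentricity of the Kepler conic with energy \<open>h\<close> and squared angular
  momentum \<open>P = c^2 - 2 * \<beta>\<close>. Next, \<open>cosf\<close> solves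
  \<open>r * (1 + e * cos f) = P\<close> for \<open>cos f\<close> at the wall point, whose radius is
  \<open>L / cos \<theta>\<close>.\<close>

definition ecc :: "real \<Rightarrow> real" where "ecc c = sqrt (1 + 2 * h * (c^2 - 2 * \<beta>))"
definition cosf :: "real \<Rightarrow> real \<Rightarrow> real" where "cosf c \<theta> = ((c^2 - 2 * \<beta>) * cos \<theta> / L - 1) / ecc c"
definition g :: "real \<Rightarrow> real \<Rightarrow> real" where "g c \<theta> = c / sqrt (c^2 - 2 * \<beta>) * arccos (cosf c \<theta>)"
text \<open>The polar angle runs from \<open>- pi/2 + \<theta>\<close> to
  \<open>- pi/2 + \<theta>'\<close> modulo a full turn, so \<open>\<Phi>\<close> is the sweep beyond
  the difference of the end angles.\<close>

definition \<Phi> :: "real \<Rightarrow> real \<Rightarrow> real \<Rightarrow> real" where "\<Phi> c \<theta> \<theta>' = g c \<theta> + g c \<theta>' + \<theta> - \<theta>'"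

lemma g_minus [simp]: "g (- c) \<theta> = - g c \<theta>" "g c (- \<theta>) = g c \<theta>"
  by (auto simp: g_def cosf_def ecc_def)

text \<open>The first symmetry is reflection in the vertical axis, which reduces negative winding to
  positive. The second is that reflection combined with time reversal; it turns statements about the
  next bounce into statements about the previous one.\<close>

lemma \<Phi>_minus: "\<Phi> (- c) (- \<theta>) (- \<theta>') = - \<Phi> c \<theta> \<theta>'" "\<Phi> c (- \<theta>') (- \<theta>) = \<Phi> c \<theta> \<theta>'"
  by (auto simp: \<Phi>_def)

lemma adm_minus [simp]: "adm (- c) = adm c" by (simp add: adm_def)

lemma ecc_ge: "adm c \<Longrightarrow> 1 \<le> ecc c"
  using h by (simp add: ecc_def adm_def)

text \<open>Here \<open>(c^2 - 2 * \<beta>) * cos \<theta>\<close> is positive and at most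
  \<open>L\<close>, while \<open>ecc c\<close> is at least 1. The nonpositive sign puts the anomaly
  at the wall beyond a right angle, the source of the lower bound on the sweep.\<close>

lemma cosf_bounds:
  assumes "adm c" "\<bar>\<theta>\<bar> \<le> 1/4"
  shows "-1 < cosf c \<theta>" "cosf c \<theta> \<le> 0" "cosf c \<theta> < 1"
proof -
  have c: "31/32 \<le> cos \<theta>" using assms by (intro cos_ge_small)
  have P: "0 < c^2 - 2 * \<beta>" "c^2 - 2 * \<beta> \<le> L" using assms \<beta> L by (auto simp: adm_def)
  have "(c^2 - 2 * \<beta>) * cos \<theta> \<le> L * 1" using P L c by (intro mult_mono) auto
  then have u: "(c^2 - 2 * \<beta>) * cos \<theta> / L - 1 \<le> 0" using L by (simp add: field_simps)
  moreover have "(c^2 - 2 * \<beta>) * cos \<theta> / L > 0" using P L c by (intro divide_pos_pos mult_pos_pos) auto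
  ultimately show "-1 < cosf c \<theta>" "cosf c \<theta> \<le> 0" using ecc_ge[OF assms(1)]
    by (auto simp: cosf_def field_simps divide_nonpos_pos)
  then show "cosf c \<theta> < 1" by simp
qed

text \<open>\<open>Q\<close> is the squared radial velocity at the wall; \<open>g c\<close> has derivative \<open>c sin \<theta> / (L sqrt Q)\<close>.\<close>

lemma sqrt_cosf:
  assumes "adm c" "\<bar>\<theta>\<bar> \<le> 1/4"
  defines "Q \<equiv> 2 * h + 2 * (cos \<theta> / L) - (c^2 - 2 * \<beta>) * (cos \<theta> / L)^2"
  shows "sqrt (1 - (cosf c \<theta>)^2) = sqrt (c^2 - 2 * \<beta>) * sqrt Q / ecc c" "1 / L \<le> Q"
proof -
  define P where "P = c^2 - 2 * \<beta>"
  define y where "y = cos \<theta> / L"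
  have P: "0 < P" "P \<le> L / 16" using assms \<beta> L by (auto simp: adm_def P_def)
  have c: "31/32 \<le> cos \<theta>" using assms by (intro cos_ge_small)
  have y: "31/32/L \<le> y" "y \<le> 1/L" using divide_right_mono[OF c, of L] divide_right_mono[OF cos_le_one[of \<theta>], of L] L
    by (simp_all add: y_def)
  have y0: "0 < y" using c L by (simp add: y_def)
  have "P * y^2 \<le> (L/16) * (1/L)^2" using P y y0 L by (intro mult_mono power_mono) auto
  then have "P * y^2 \<le> 1/16/L" using L by (simp add: power2_eq_square)
  moreover have "1/L \<le> 2 * (31/32/L) - 1/16/L" using L by (simp add: field_simps)
  ultimately show Q: "1 / L \<le> Q" using y h unfolding Q_def P_def[symmetric] y_def[symmetric] by linarith
  have "0 \<le> 1 + 2 * h * P" using mult_pos_pos[OF h P(1)] by linarith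
  then have e: "0 < ecc c" "(ecc c)^2 = 1 + 2 * h * P"
    using ecc_ge[OF assms(1)] by (simp, simp add: ecc_def P_def[symmetric])
  have X: "cosf c \<theta> = (P * y - 1) / ecc c" by (simp add: cosf_def P_def y_def)
  have "1 - (cosf c \<theta>)^2 = ((ecc c)^2 - (P * y - 1)^2) / (ecc c)^2"
    unfolding X power_divide using e(1) by (simp add: diff_divide_distrib)
  also have "\<dots> = P * Q / (ecc c)^2" unfolding e(2) Q_def P_def[symmetric] y_def[symmetric]
    by (simp add: power2_eq_square algebra_simps)
  finally have 1: "1 - (cosf c \<theta>)^2 = P * Q / (ecc c)^2" .
  show "sqrt (1 - (cosf c \<theta>)^2) = sqrt (c^2 - 2 * \<beta>) * sqrt Q / ecc c"
    unfolding 1 P_def[symmetric] real_sqrt_divide real_sqrt_mult real_sqrt_abs using e(1) by simp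
qed

text \<open>Since \<open>c^2 \<le> L / 16\<close> and \<open>1 / L \<le> Q\<close>,
  \<open>\<bar>c\<bar>\<close> is at most \<open>L * sqrt Q / 4\<close>, so the derivative is within
  the bound. A constant below 1 makes \<open>\<theta> + g c \<theta>\<close> and
  \<open>\<theta> - g c \<theta>\<close> strictly increasing.\<close>

lemma g_lipschitz:
  assumes c: "adm c" and x: "\<bar>x\<bar> \<le> 1/4" "\<bar>y\<bar> \<le> 1/4"
  shows "\<bar>g c x - g c y\<bar> \<le> 1/2 * \<bar>x - y\<bar>"
proof -
  define Q where "Q \<theta> = 2 * h + 2 * (cos \<theta> / L) - (c^2 - 2 * \<beta>) * (cos \<theta> / L)^2" for \<theta>
  have P: "0 < c^2 - 2 * \<beta>" using c by (simp add: adm_def)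
  have e: "0 < ecc c" using ecc_ge[OF c] by simp
  have d: "(g c has_field_derivative c * sin \<theta> / (L * sqrt (Q \<theta>))) (at \<theta> within {-1/4..1/4})"
    and b: "norm (c * sin \<theta> / (L * sqrt (Q \<theta>))) \<le> 1/2" if "\<theta> \<in> {-1/4..1/4}" for \<theta>
  proof -
    have th: "\<bar>\<theta>\<bar> \<le> 1/4" using that by auto
    note s = sqrt_cosf[OF c th, folded Q_def]
    have "0 < 1 / L" using L by simp
    then have Q: "Q \<theta> > 0" using s(2) by linarith
    have "sqrt (c^2 - 2 * \<beta>) * sqrt (c^2 - 2 * \<beta>) = c^2 - 2 * \<beta>" using P by simp
    then have eq: "- (c / sqrt (c^2 - 2 * \<beta>) * (((c^2 - 2 * \<beta>) * sin \<theta> / L) / ecc c * inverse (- sqrt (1 - (cosf c \<theta>)^2))))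
        = c * sin \<theta> / (L * sqrt (Q \<theta>))"
      unfolding s using P e Q L by (simp add: field_simps)
    have "(cosf c has_field_derivative - ((c^2 - 2 * \<beta>) * sin \<theta> / L) / ecc c) (at \<theta> within {-1/4..1/4})"
      unfolding cosf_def by (auto intro!: derivative_eq_intros simp: e[THEN less_imp_neq, symmetric] L[THEN less_imp_neq, symmetric])
    then have "((\<lambda>\<theta>. arccos (cosf c \<theta>)) has_field_derivative
        inverse (- sqrt (1 - (cosf c \<theta>)^2)) * (- ((c^2 - 2 * \<beta>) * sin \<theta> / L) / ecc c)) (at \<theta> within {-1/4..1/4})"
      using cosf_bounds[OF c th] by (intro DERIV_chain2[OF DERIV_arccos]) auto
    then have "(g c has_field_derivative c / sqrt (c^2 - 2 * \<beta>) *
        (inverse (- sqrt (1 - (cosf c \<theta>)^2)) * (- ((c^2 - 2 * \<beta>) * sin \<theta> / L) / ecc c))) (at \<theta> within {-1/4..1/4})"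
      unfolding g_def by (rule DERIV_cmult)
    then show "(g c has_field_derivative c * sin \<theta> / (L * sqrt (Q \<theta>))) (at \<theta> within {-1/4..1/4})"
      unfolding eq[symmetric] by (simp add: algebra_simps)
    have "\<bar>c\<bar> \<le> L * sqrt (Q \<theta>) / 4"
    proof (rule power2_le_imp_le)
      have "L * 1 \<le> L * (L * Q \<theta>)" using s(2) L by (intro mult_left_mono) (auto simp: field_simps)
      then have "L / 16 \<le> (L * sqrt (Q \<theta>) / 4)^2"
        using Q real_sqrt_pow2[of "Q \<theta>"] by (simp only: power_divide power_mult_distrib) (simp add: power2_eq_square)
      then show "\<bar>c\<bar>^2 \<le> (L * sqrt (Q \<theta>) / 4)^2" using c by (simp add: adm_def)
    qed (use L Q in auto)
    then have "\<bar>c\<bar> * \<bar>sin \<theta>\<bar> \<le> (L * sqrt (Q \<theta>) / 4) * 1" using L Q by (intro mult_mono) auto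
    moreover have "L * sqrt (Q \<theta>) > 0" using L Q by simp
    ultimately show "norm (c * sin \<theta> / (L * sqrt (Q \<theta>))) \<le> 1/2"
      using Q by (simp add: abs_mult abs_of_pos[OF L] divide_le_eq)
  qed
  have "norm (g c x - g c y) \<le> 1/2 * norm (x - y)"
    by (rule field_differentiable_bound[where S = "{-1/4..1/4}"]) (use d b x in auto)
  then show ?thesis by simp
qed

lemma tendsto_g:
  assumes "(c \<longlongrightarrow> c0) F" "(\<theta> \<longlongrightarrow> \<theta>0) F" "adm c0" "\<bar>\<theta>0\<bar> \<le> 1/4"
  shows "((\<lambda>n. g (c n) (\<theta> n)) \<longlongrightarrow> g c0 \<theta>0) F"
proof -
  have P: "0 < c0^2 - 2 * \<beta>" using assms by (simp add: adm_def)
  have "((\<lambda>n. cosf (c n) (\<theta> n)) \<longlongrightarrow> cosf c0 \<theta>0) F"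
    unfolding cosf_def ecc_def using ecc_ge[OF assms(3)] L
    by (intro tendsto_intros isCont_tendsto_compose[OF isCont_cos] assms) (auto simp: ecc_def)
  then have "((\<lambda>n. arccos (cosf (c n) (\<theta> n))) \<longlongrightarrow> arccos (cosf c0 \<theta>0)) F"
    using cosf_bounds[OF assms(3,4)] by (intro isCont_tendsto_compose[OF isCont_arccos]) auto
  then show ?thesis unfolding g_def using P by (intro tendsto_intros assms) auto
qed

section \<open>Angular momentum for a prescribed winding number and prescribed end points\<close>

lemma sqrt_L: "adm (sqrt L / 4)" using L \<beta> by (simp add: adm_def power_divide)

text \<open>At the largest \<open>c\<close> the cosine of the anomaly stays above -16/17, while
  \<open>cos (pi - 1/3)\<close> is at most -17/18. So the anomaly misses \<open>pi\<close> by 1/3,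
  and stretching by 99/98 uses up less than the 1/12 to spare.\<close>

lemma g_upper:
  assumes "\<bar>\<theta>\<bar> \<le> 1/4" shows "g (sqrt L / 4) \<theta> < pi - 1/4"
proof -
  define P where "P = (sqrt L / 4)^2 - 2 * \<beta>"
  have P: "P \<ge> 49/50 * (L/16)" using L \<beta> by (simp add: P_def power_divide)
  then have P0: "P > 0" using L by linarith
  have "49/50 * (L/16) * (31/32) \<le> P * cos \<theta>"
    using P P0 cos_ge_small[OF assms] L by (intro mult_mono) auto
  then have "1/17 * L \<le> P * cos \<theta>" using L by simp
  then have n: "-16/17 \<le> P * cos \<theta> / L - 1" using L by (simp add: field_simps)
  have e: "1 \<le> ecc (sqrt L / 4)" by (rule ecc_ge[OF sqrt_L])
  have X: "-16/17 \<le> cosf (sqrt L / 4) \<theta>"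
  proof -
    have "-16/17 * ecc (sqrt L / 4) \<le> -16/17" using e by simp
    also have "\<dots> \<le> P * cos \<theta> / L - 1" by (rule n)
    finally show ?thesis using e unfolding cosf_def P_def[symmetric] by (simp add: field_simps)
  qed
  have "cos (pi - 1/3) \<le> -16/17" using cos_ge_quadratic[of "1/3"] by (simp add: power_divide)
  then have "arccos (cosf (sqrt L / 4) \<theta>) \<le> arccos (cos (pi - 1/3))"
    using X cosf_bounds[OF sqrt_L assms] by (intro arccos_le_arccos) auto
  also have "\<dots> = pi - 1/3" using pi_gt3 by (intro arccos_cos) auto
  finally have a: "arccos (cosf (sqrt L / 4) \<theta>) \<le> pi - 1/3" .
  have "(98/99 * (sqrt L / 4))^2 \<le> P" using P L by (simp add: power_mult_distrib power_divide)
  then have "98/99 * (sqrt L / 4) \<le> sqrt P" by (rule real_le_rsqrt)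
  then have l: "(sqrt L / 4) / sqrt P \<le> 99/98" using P0 by (simp add: field_simps)
  have "g (sqrt L / 4) \<theta> \<le> 99/98 * (pi - 1/3)" unfolding g_def P_def[symmetric]
    using l a P0 L cosf_bounds[OF sqrt_L assms] by (intro mult_mono) (auto intro!: arccos_lbound)
  also have "\<dots> < pi - 1/4" using pi_less_4 by simp
  finally show ?thesis .
qed

lemma \<Phi>_upper: "\<bar>\<theta>\<bar> \<le> 1/4 \<Longrightarrow> \<bar>\<theta>'\<bar> \<le> 1/4 \<Longrightarrow> \<Phi> (sqrt L / 4) \<theta> \<theta>' \<le> 2 * pi"
  using g_upper[of \<theta>] g_upper[of \<theta>'] unfolding \<Phi>_def by linarith

text \<open>If the stretching factor is \<open>l = 2 * k + 2\<close>, each half of the arc sweeps at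
  least \<open>l * (pi / 2)\<close>, and the surplus \<open>2 * pi\<close> dominates the end angles.
  The same \<open>c\<close> works for all end points.\<close>

lemma \<Phi>_lower:
  assumes "0 < k"
  shows "\<exists>c. sqrt (2 * \<beta>) < c \<and> c \<le> sqrt L / 4 \<and> 
    (\<forall>\<theta> \<theta>'. \<bar>\<theta>\<bar> \<le> 1/4 \<longrightarrow> \<bar>\<theta>'\<bar> \<le> 1/4 \<longrightarrow> 2 * pi * real_of_int k \<le> \<Phi> c \<theta> \<theta>')"
proof -
  define l where "l = 2 * real_of_int k + 2"
  have l4: "l \<ge> 4" using assms by (simp add: l_def)
  then have l: "l^2 \<ge> 16" using power_mono[of 4 l 2] by simp
  \<comment> \<open>The value of \<open>c^2\<close> obtained from
    \<open>c^2 / (c^2 - 2 * \<beta>) = l^2\<close>.\<close>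
  define q where "q = 2 * \<beta> * (l^2 / (l^2 - 1))"
  have qP: "q - 2 * \<beta> = 2 * \<beta> / (l^2 - 1)" using l by (simp add: q_def field_simps)
  have "2 * \<beta> / (l^2 - 1) > 0" using l \<beta> by simp
  then have q2: "q > 2 * \<beta>" using qP by linarith
  have "l^2 / (l^2 - 1) \<le> 2" using l by (simp add: field_simps)
  then have "q \<le> 2 * \<beta> * 2" unfolding q_def using \<beta> by (intro mult_left_mono) auto
  then have qL: "q \<le> L / 16" using \<beta> L by linarith
  have c2: "(sqrt q)^2 = q" using q2 \<beta> by simp
  have ql: "q / (q - 2 * \<beta>) = l^2" unfolding qP unfolding q_def using \<beta> l by (simp add: field_simps)
  have lam: "sqrt q / sqrt ((sqrt q)^2 - 2 * \<beta>) = l"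
    unfolding c2 real_sqrt_divide[symmetric] ql using l4 by simp
  have ad: "adm (sqrt q)" using q2 qL c2 by (simp add: adm_def)
  have "sqrt (2 * \<beta>) < sqrt q" using q2 by simp
  moreover have "sqrt q \<le> sqrt L / 4" using real_sqrt_le_mono[OF qL] by (simp add: real_sqrt_divide)
  moreover have "2 * pi * real_of_int k \<le> \<Phi> (sqrt q) \<theta> \<theta>'" if "\<bar>\<theta>\<bar> \<le> 1/4" "\<bar>\<theta>'\<bar> \<le> 1/4" for \<theta> \<theta>'
  proof -
    have "g (sqrt q) t \<ge> l * (pi / 2)" if t: "\<bar>t\<bar> \<le> 1/4" for t
    proof -
      have "arccos 0 \<le> arccos (cosf (sqrt q) t)" using cosf_bounds[OF ad t] by (intro arccos_le_arccos) auto
      then show ?thesis unfolding g_def lam using l4 by (intro mult_left_mono) auto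
    qed
    from this[OF that(1)] this[OF that(2)] have "\<Phi> (sqrt q) \<theta> \<theta>' \<ge> l * pi - 1/2"
      using that unfolding \<Phi>_def by (simp add: field_simps abs_le_iff)
    then show ?thesis using pi_gt3 by (simp add: l_def algebra_simps)
  qed
  ultimately show ?thesis by blast
qed

text \<open>Several \<open>c\<close> may solve the winding equation; taking the supremum of a
  superlevel set selects the largest and makes the choice monotone in the end points.\<close>

definition angmom_pos :: "int \<Rightarrow> real \<Rightarrow> real \<Rightarrow> real" where
  "angmom_pos k \<theta> \<theta>' = Sup {c\<in>{sqrt (2 * \<beta>)<..sqrt L / 4}. 0 \<le> \<Phi> c \<theta> \<theta>' - 2 * pi * real_of_int k}"

lemma adm_interval: "c \<in> {sqrt (2 * \<beta>)<..sqrt L / 4} \<Longrightarrow> adm c"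
proof -
  assume c: "c \<in> {sqrt (2 * \<beta>)<..sqrt L / 4}"
  have s: "0 \<le> sqrt (2 * \<beta>)" using \<beta> by simp
  then have c0: "0 \<le> c" using c by (meson greaterThanAtMost_iff less_imp_le order_trans)
  have "(sqrt (2 * \<beta>))^2 < c^2" using c s by (intro power_strict_mono) auto
  moreover have "c^2 \<le> (sqrt L / 4)^2" using c c0 by (intro power_mono) auto
  ultimately show ?thesis using \<beta> L by (simp add: adm_def power_divide)
qed

text \<open>Intermediate values between the \<open>c0\<close> of \<open>\<Phi>_lower\<close> and the
  top of the range, where \<open>\<Phi>\<close> is at most one full turn.\<close>

lemma angmom_pos:
  assumes k: "0 < k" and t: "\<bar>\<theta>\<bar> \<le> 1/4" "\<bar>\<theta>'\<bar> \<le> 1/4"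
  shows "adm (angmom_pos k \<theta> \<theta>')" "\<Phi> (angmom_pos k \<theta> \<theta>') \<theta> \<theta>' = 2 * pi * real_of_int k"
proof -
  obtain c0 where c0: "sqrt (2 * \<beta>) < c0" "c0 \<le> sqrt L / 4" "2 * pi * real_of_int k \<le> \<Phi> c0 \<theta> \<theta>'"
    using \<Phi>_lower[OF k] t by blast
  have ad: "adm c" if "c \<in> {c0..sqrt L / 4}" for c using that c0 by (intro adm_interval) auto
  have "continuous_on {c0..sqrt L / 4} (\<lambda>c. \<Phi> c \<theta> \<theta>' - 2 * pi * real_of_int k)"
    unfolding continuous_on_def \<Phi>_def
    by (intro ballI tendsto_intros tendsto_g ad t) 
  moreover have "\<Phi> (sqrt L / 4) \<theta> \<theta>' - 2 * pi * real_of_int k \<le> 0"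
  proof -
    have "2 * pi * 1 \<le> 2 * pi * real_of_int k" using k by (intro mult_left_mono) auto
    then show ?thesis using \<Phi>_upper[OF t] by linarith
  qed
  moreover have "0 \<le> \<Phi> c0 \<theta> \<theta>' - 2 * pi * real_of_int k" using c0 by simp
  moreover have "{c0..sqrt L / 4} \<subseteq> {sqrt (2 * \<beta>)<..sqrt L / 4}" "{sqrt (2 * \<beta>)<..sqrt L / 4} \<subseteq> {..sqrt L / 4}"
    using c0 by auto
  ultimately have "angmom_pos k \<theta> \<theta>' \<in> {c0..sqrt L / 4} \<and>
    \<Phi> (angmom_pos k \<theta> \<theta>') \<theta> \<theta>' - 2 * pi * real_of_int k = 0"
    unfolding angmom_pos_def
    using Sup_root[of c0 "sqrt L / 4" "\<lambda>c. \<Phi> c \<theta> \<theta>' - 2 * pi * real_of_int k" "{sqrt (2 * \<beta>)<..sqrt L / 4}"] c0(2)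
    by blast
  then show "adm (angmom_pos k \<theta> \<theta>')" "\<Phi> (angmom_pos k \<theta> \<theta>') \<theta> \<theta>' = 2 * pi * real_of_int k"
    using ad by auto
qed

text \<open>The linear terms \<open>\<theta> - \<theta>'\<close> outweigh the variation of
  \<open>g c\<close>, which is a contraction.\<close>

lemma \<Phi>_mono:
  assumes "adm c" "\<bar>x\<bar> \<le> 1/4" "\<bar>x'\<bar> \<le> 1/4" "\<bar>y\<bar> \<le> 1/4" "\<bar>y'\<bar> \<le> 1/4" "x \<le> y" "y' \<le> x'"
  shows "\<Phi> c x x' \<le> \<Phi> c y y'"
  using g_lipschitz[OF assms(1,2,4)] g_lipschitz[OF assms(1,3,5)] assms(6,7)
  unfolding \<Phi>_def by (simp add: abs_if split: if_splits)

lemma angmom_pos_mono: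
  assumes k: "0 < k" and t: "\<bar>x\<bar> \<le> 1/4" "\<bar>x'\<bar> \<le> 1/4" "\<bar>y\<bar> \<le> 1/4" "\<bar>y'\<bar> \<le> 1/4" and le: "x \<le> y" "y' \<le> x'"
  shows "angmom_pos k x x' \<le> angmom_pos k y y'"
  unfolding angmom_pos_def
proof (rule cSup_subset_mono)
  show "{c \<in> {sqrt (2 * \<beta>)<..sqrt L / 4}. 0 \<le> \<Phi> c x x' - 2 * pi * real_of_int k} \<noteq> {}"
    using \<Phi>_lower[OF k] t by fastforce
  show "bdd_above {c \<in> {sqrt (2 * \<beta>)<..sqrt L / 4}. 0 \<le> \<Phi> c y y' - 2 * pi * real_of_int k}"
    by (rule bdd_aboveI[of _ "sqrt L / 4"]) auto
  have "\<Phi> c x x' \<le> \<Phi> c y y'" if "c \<in> {sqrt (2 * \<beta>)<..sqrt L / 4}" for c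
    using that t le by (intro \<Phi>_mono adm_interval) auto
  then show "{c \<in> {sqrt (2 * \<beta>)<..sqrt L / 4}. 0 \<le> \<Phi> c x x' - 2 * pi * real_of_int k}
    \<subseteq> {c \<in> {sqrt (2 * \<beta>)<..sqrt L / 4}. 0 \<le> \<Phi> c y y' - 2 * pi * real_of_int k}" by fastforce
qed

text \<open>Negative \<open>k\<close> are mirrored to positive ones. The sign changes inside and
  outside cancel, so the direction of monotonicity is the same for both signs of
  \<open>k\<close>.\<close>

definition angmom :: "int \<Rightarrow> real \<Rightarrow> real \<Rightarrow> real" where
  "angmom k \<theta> \<theta>' = (if 0 < k then angmom_pos k \<theta> \<theta>' else - angmom_pos (- k) (- \<theta>) (- \<theta>'))"

lemma angmom:
  assumes "k \<noteq> 0" "\<bar>\<theta>\<bar> \<le> 1/4" "\<bar>\<theta>'\<bar> \<le> 1/4"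
  shows "adm (angmom k \<theta> \<theta>')" "\<Phi> (angmom k \<theta> \<theta>') \<theta> \<theta>' = 2 * pi * real_of_int k"
proof -
  have "adm (angmom k \<theta> \<theta>') \<and> \<Phi> (angmom k \<theta> \<theta>') \<theta> \<theta>' = 2 * pi * real_of_int k"
  proof (cases "0 < k")
    case True then show ?thesis using angmom_pos[of k \<theta> \<theta>'] assms by (simp add: angmom_def)
  next
    case False then show ?thesis
      using angmom_pos[of "-k" "-\<theta>" "-\<theta>'"] assms \<Phi>_minus(1)[of "angmom_pos (-k) (-\<theta>) (-\<theta>')" "-\<theta>" "-\<theta>'"]
      by (simp add: angmom_def)
  qed
  then show "adm (angmom k \<theta> \<theta>')" "\<Phi> (angmom k \<theta> \<theta>') \<theta> \<theta>' = 2 * pi * real_of_int k" by auto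
qed

lemma angmom_mono:
  assumes "k \<noteq> 0" "\<bar>x\<bar> \<le> 1/4" "\<bar>x'\<bar> \<le> 1/4" "\<bar>y\<bar> \<le> 1/4" "\<bar>y'\<bar> \<le> 1/4" "x \<le> y" "y' \<le> x'"
  shows "angmom k x x' \<le> angmom k y y'"
proof (cases "0 < k")
  case True
  then show ?thesis using angmom_pos_mono[OF True assms(2-7)] by (simp add: angmom_def)
next
  case False
  then show ?thesis using angmom_pos_mono[of "-k" "-y" "-y'" "-x" "-x'"] assms by (simp add: angmom_def)
qed

section \<open>Velocity angles at the wall and the bounce point between two arcs\<close>

definition speed :: "real \<Rightarrow> real" where
  "speed \<theta> = sqrt (2 * h + 2 * (cos \<theta> / L) + 2 * \<beta> * (cos \<theta> / L)^2)"

text \<open>The angle between the velocity and the radius at the wall.\<close>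

definition att :: "real \<Rightarrow> real \<Rightarrow> real" where "att \<theta> c = arcsin (c * cos \<theta> / (L * speed \<theta>))"

lemma speed_sq:
  assumes "\<bar>\<theta>\<bar> \<le> 1/4"
  shows "(speed \<theta>)^2 = 2 * h + 2 * (cos \<theta> / L) + 2 * \<beta> * (cos \<theta> / L)^2"
    "31/16/L \<le> (speed \<theta>)^2" "0 < speed \<theta>"
proof -
  have c: "31/32/L \<le> cos \<theta>/L" using cos_ge_small[OF assms] L by (intro divide_right_mono) auto
  have "0 \<le> 2 * \<beta> * (cos \<theta> / L)^2" using \<beta> by simp
  then have b: "31/16/L \<le> 2 * h + 2 * (cos \<theta> / L) + 2 * \<beta> * (cos \<theta> / L)^2" using c h by simp
  have "0 < 31/16/L" using L by simp
  then show "0 < speed \<theta>" using b unfolding speed_def real_sqrt_gt_0_iff by linarith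
  show 1: "(speed \<theta>)^2 = 2 * h + 2 * (cos \<theta> / L) + 2 * \<beta> * (cos \<theta> / L)^2"
    unfolding speed_def using b \<open>0 < 31/16/L\<close> by (intro real_sqrt_pow2) linarith
  show "31/16/L \<le> (speed \<theta>)^2" using b 1 by simp
qed

text \<open>The squared ratio is at most \<open>(L/16) / (31/16 * L) = 1/31\<close>, below
  1/25.\<close>

lemma att_arg:
  assumes "\<bar>\<theta>\<bar> \<le> 1/4" "adm c"
  shows "\<bar>c * cos \<theta> / (L * speed \<theta>)\<bar> \<le> 1/5"
proof -
  have s: "31/16/L \<le> (speed \<theta>)^2" "0 < speed \<theta>" using speed_sq[OF assms(1)] by auto
  have "\<bar>c * cos \<theta>\<bar> \<le> 1/5 * (L * speed \<theta>)"
  proof (rule power2_le_imp_le)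
    have "c^2 * (cos \<theta>)^2 \<le> L/16 * 1" using assms by (intro mult_mono) (auto simp: adm_def abs_square_le_1 L less_imp_le)
    moreover have "L * (31/16) \<le> L * (L * (speed \<theta>)^2)" using s L by (intro mult_left_mono) (auto simp: field_simps)
    then have "1/25 * (L * (31/16)) \<le> (1/5 * (L * speed \<theta>))^2"
      by (simp only: power_mult_distrib power_divide) (simp add: power2_eq_square)
    ultimately show "\<bar>c * cos \<theta>\<bar>^2 \<le> (1/5 * (L * speed \<theta>))^2" using L
      by (simp add: power_mult_distrib)
  qed (use s L in auto)
  then show ?thesis using s L by (simp add: abs_mult field_simps)
qed

lemma att_bound: "\<bar>\<theta>\<bar> \<le> 1/4 \<Longrightarrow> adm c \<Longrightarrow> \<bar>att \<theta> c\<bar> \<le> 1/4"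
  unfolding att_def by (intro arcsin_small att_arg)

lemma sin_att: "\<bar>\<theta>\<bar> \<le> 1/4 \<Longrightarrow> adm c \<Longrightarrow> sin (att \<theta> c) = c * cos \<theta> / (L * speed \<theta>)"
  unfolding att_def using att_arg[of \<theta> c] by (intro sin_arcsin; linarith)

text \<open>Recovers \<open>c\<close> from the angle, so that the reflection law can be solved for
  the next or the previous angular momentum.\<close>

lemma angmom_att: 
  assumes "\<bar>\<theta>\<bar> \<le> 1/4" "adm c" shows "c = L * speed \<theta> / cos \<theta> * sin (att \<theta> c)"
  using sin_att[OF assms] speed_sq[OF assms(1)] cos_ge_small[OF assms(1)] L by simp

lemma att_mono: "\<bar>\<theta>\<bar> \<le> 1/4 \<Longrightarrow> adm c \<Longrightarrow> adm c' \<Longrightarrow> c \<le> c' \<Longrightarrow> att \<theta> c \<le> att \<theta> c'"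
  unfolding att_def
proof (rule arcsin_le_arcsin)
  assume *: "\<bar>\<theta>\<bar> \<le> 1/4" "adm c" "adm c'" "c \<le> c'"
  show "- 1 \<le> c * cos \<theta> / (L * speed \<theta>)" "c' * cos \<theta> / (L * speed \<theta>) \<le> 1"
    using att_arg[OF *(1,2)] att_arg[OF *(1,3)] by linarith+
  show "c * cos \<theta> / (L * speed \<theta>) \<le> c' * cos \<theta> / (L * speed \<theta>)"
    using * speed_sq(3)[OF *(1)] cos_ge_small[OF *(1)] L by (intro divide_right_mono mult_right_mono) auto
qed

lemma tendsto_speed:
  assumes "(\<theta> \<longlongrightarrow> \<theta>0) F"
  shows "((\<lambda>n. speed (\<theta> n)) \<longlongrightarrow> speed \<theta>0) F"
  unfolding speed_def using L by (intro tendsto_intros isCont_tendsto_compose[OF isCont_cos] assms) auto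

lemma tendsto_att:
  assumes "(c \<longlongrightarrow> c0) F" "(\<theta> \<longlongrightarrow> \<theta>0) F" "adm c0" "\<bar>\<theta>0\<bar> \<le> 1/4"
  shows "((\<lambda>n. att (\<theta> n) (c n)) \<longlongrightarrow> att \<theta>0 c0) F"
  unfolding att_def
proof (rule isCont_tendsto_compose[OF isCont_arcsin])
  show "- 1 < c0 * cos \<theta>0 / (L * speed \<theta>0)" "c0 * cos \<theta>0 / (L * speed \<theta>0) < 1"
    using att_arg[OF assms(4,3)] by linarith+
  show "((\<lambda>n. c n * cos (\<theta> n) / (L * speed (\<theta> n))) \<longlongrightarrow> c0 * cos \<theta>0 / (L * speed \<theta>0)) F"
    using speed_sq[OF assms(4)] L by (intro tendsto_intros isCont_tendsto_compose[OF isCont_cos] tendsto_speed assms) auto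
qed

text \<open>The largest place on the wall where the reflection law can turn incoming
  \<open>c\<close> into outgoing \<open>c'\<close>.\<close>

definition bounce :: "real \<Rightarrow> real \<Rightarrow> real" where
  "bounce c c' = Sup {\<theta>\<in>{-1/4..1/4}. 0 \<le> att \<theta> c' - att \<theta> c - 2 * \<theta>}"

text \<open>Two angles of size at most 1/4 differ by at most \<open>2 * (1/4)\<close>, so the defect
  in the reflection law changes sign across the box.\<close>

lemma bounce:
  assumes c: "adm c" "adm c'"
  shows "\<bar>bounce c c'\<bar> \<le> 1/4" "att (bounce c c') c' - att (bounce c c') c = 2 * bounce c c'"
proof -
  have "continuous_on {-1/4..1/4} (\<lambda>\<theta>. att \<theta> c' - att \<theta> c - 2 * \<theta>)"
    unfolding continuous_on_def by (intro ballI tendsto_intros tendsto_att c) auto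
  moreover have "0 \<le> att (-1/4) c' - att (-1/4) c - 2 * (-1/4)" "att (1/4) c' - att (1/4) c - 2 * (1/4) \<le> 0"
    using att_bound[of "-1/4" c] att_bound[of "-1/4" c'] att_bound[of "1/4" c] att_bound[of "1/4" c'] c
    by (auto simp: abs_le_iff)
  ultimately have "bounce c c' \<in> {-1/4..1/4} \<and> att (bounce c c') c' - att (bounce c c') c - 2 * bounce c c' = 0"
    unfolding bounce_def
    using Sup_root[of "-1/4" "1/4" "\<lambda>\<theta>. att \<theta> c' - att \<theta> c - 2 * \<theta>" "{-1/4..1/4}"] by simp
  then show "\<bar>bounce c c'\<bar> \<le> 1/4" "att (bounce c c') c' - att (bounce c c') c = 2 * bounce c c'" by auto
qed

lemma bounce_mono:
  assumes c: "adm c" "adm c'" "adm d" "adm d'" and le: "d \<le> c" "c' \<le> d'"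
  shows "bounce c c' \<le> bounce d d'"
  unfolding bounce_def
proof (rule cSup_subset_mono)
  show "{\<theta> \<in> {-1/4..1/4}. 0 \<le> att \<theta> c' - att \<theta> c - 2 * \<theta>} \<noteq> {}"
    using bounce[OF c(1,2)] by (auto intro!: exI[of _ "bounce c c'"])
  show "bdd_above {\<theta> \<in> {-1/4..1/4}. 0 \<le> att \<theta> d' - att \<theta> d - 2 * \<theta>}"
    by (rule bdd_aboveI[of _ "1/4"]) auto
  have "att \<theta> c' - att \<theta> c \<le> att \<theta> d' - att \<theta> d" if "\<theta> \<in> {-1/4..1/4}" for \<theta>
    using that c le by (intro diff_mono att_mono) auto
  then show "{\<theta> \<in> {-1/4..1/4}. 0 \<le> att \<theta> c' - att \<theta> c - 2 * \<theta>}
    \<subseteq> {\<theta> \<in> {-1/4..1/4}. 0 \<le> att \<theta> d' - att \<theta> d - 2 * \<theta>}" by fastforce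
qed

section \<open>Bi-infinite chains of arcs\<close>

text \<open>Index convention: arc \<open>i\<close>, with angular momentum \<open>c i\<close>, leaves
  bounce \<open>i\<close> and ends at bounce \<open>i + 1\<close>; hence \<open>c (i - 1)\<close> is
  incoming at bounce \<open>i\<close>.\<close>

definition chain :: "(int \<Rightarrow> real) \<Rightarrow> (int \<Rightarrow> real) \<Rightarrow> (int \<Rightarrow> int) \<Rightarrow> bool" where
  "chain \<theta> c k \<longleftrightarrow> (\<forall>i. \<bar>\<theta> i\<bar> \<le> 1/4 \<and> adm (c i) \<and> \<Phi> (c i) (\<theta> i) (\<theta> (i + 1)) = 2 * pi * real_of_int (k i) \<and>
     att (\<theta> i) (c i) - att (\<theta> i) (c (i - 1)) = 2 * \<theta> i)"

text \<open>After the sign change \<open>\<theta> i = (-1)^i \<psi> i\<close> the equations of motion form a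
  monotone system, so a solution exists by the Knaster--Tarski argument.\<close>

lemma chain_exists:
  assumes s: "\<And>i. s i \<noteq> 0"
  shows "\<exists>\<theta> c. chain \<theta> c s"
proof -
  define sg :: "int \<Rightarrow> real" where "sg i = (if even i then 1 else -1)" for i
  define C where "C \<psi> i = angmom (s i) (sg i * \<psi> i) (sg (i + 1) * \<psi> (i + 1))" for \<psi> i
  define M where "M \<psi> i = sg i * bounce (C \<psi> (i - 1)) (C \<psi> i)" for \<psi> i
  have sg: "\<bar>sg i * x\<bar> = \<bar>x\<bar>" "sg i * (sg i * x) = x" for i x by (auto simp: sg_def)
  have C: "adm (C \<psi> i)" if "\<And>i. \<psi> i \<in> {-1/4..1/4}" for \<psi> i
    unfolding C_def using that[of i] that[of "i+1"] by (intro angmom s) (auto simp: sg abs_le_iff)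
  \<comment> \<open>\<open>angmom\<close> increases in its first end point and decreases in its
    second, and neighbouring signs \<open>sg\<close> are opposite, so both effects agree. The same
    holds for \<open>bounce\<close>, which decreases in the incoming and increases in the outgoing
    argument.\<close>
  have Cm: "sg i * C x i \<le> sg i * C y i" if "\<And>i. x i \<in> {-1/4..1/4}" "\<And>i. y i \<in> {-1/4..1/4}" "\<And>i. x i \<le> y i" for x y i
    using that(1)[of i] that(1)[of "i+1"] that(2)[of i] that(2)[of "i+1"] that(3)[of i] that(3)[of "i+1"] s[of i]
    unfolding C_def sg_def by (cases "even i") (auto intro!: angmom_mono)
  have "\<exists>\<psi>. (\<forall>i. \<psi> i \<in> {-1/4..1/4}) \<and> (\<forall>i. M \<psi> i = \<psi> i)"
  proof (rule monotone_box_fixpoint)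
    fix \<psi> :: "int \<Rightarrow> real" and i assume "\<And>i. \<psi> i \<in> {-1/4..1/4}"
    note C[OF this]
    then have "\<bar>M \<psi> i\<bar> \<le> 1/4" unfolding M_def sg by (intro bounce)
    then show "M \<psi> i \<in> {-1/4..1/4}" by auto
  next
    fix x y :: "int \<Rightarrow> real" and i
    assume xy: "\<And>i. x i \<in> {-1/4..1/4}" "\<And>i. y i \<in> {-1/4..1/4}" "\<And>i. x i \<le> y i"
    show "M x i \<le> M y i"
      using Cm[OF xy, of i] Cm[OF xy, of "i - 1"] C[OF xy(1)] C[OF xy(2)]
      unfolding M_def sg_def by (cases "even i") (auto intro!: bounce_mono)
  qed auto
  then obtain \<psi> where box: "\<And>i. \<psi> i \<in> {-1/4..1/4}" and fp: "\<And>i. M \<psi> i = \<psi> i" by blast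
  define \<theta> where "\<theta> i = sg i * \<psi> i" for i
  have th: "\<theta> i = bounce (C \<psi> (i - 1)) (C \<psi> i)" for i
    unfolding \<theta>_def fp[of i, symmetric] by (simp add: M_def sg)
  have ab: "\<bar>\<theta> i\<bar> \<le> 1/4" for i using box[of i] by (auto simp: \<theta>_def sg abs_le_iff)
  have Ceq: "C \<psi> i = angmom (s i) (\<theta> i) (\<theta> (i + 1))" for i by (simp add: C_def \<theta>_def)
  have "\<Phi> (C \<psi> i) (\<theta> i) (\<theta> (i + 1)) = 2 * pi * real_of_int (s i)" for i
    unfolding Ceq by (intro angmom s ab)
  then have "chain \<theta> (C \<psi>) s" unfolding chain_def using ab C[OF box] bounce[OF C[OF box] C[OF box]]
    by (auto simp: th)
  then show ?thesis by blast
qed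

section \<open>Realizing the arcs\<close>

definition pos :: "real \<Rightarrow> complex" where "pos \<theta> = Complex (L * tan \<theta>) (- L)"

text \<open>The radius at the wall point is tilted by \<open>\<theta>\<close>, so the departing
  velocity makes the angle \<open>att \<theta> c - \<theta>\<close> with the upward normal. The
  arriving velocity \<open>vout\<close>, before reflection, makes
  \<open>att \<theta> c + \<theta>\<close> with the downward one.\<close>

definition vin :: "real \<Rightarrow> real \<Rightarrow> complex" where
  "vin \<theta> c = Complex (speed \<theta> * sin (att \<theta> c - \<theta>)) (speed \<theta> * cos (att \<theta> c - \<theta>))"

definition vout :: "real \<Rightarrow> real \<Rightarrow> complex" where
  "vout \<theta> c = Complex (speed \<theta> * sin (att \<theta> c + \<theta>)) (- (speed \<theta> * cos (att \<theta> c + \<theta>)))"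

text \<open>Pythagoras: the transverse velocity is \<open>c * cos \<theta> / L\<close>, and removing
  its square from that of the speed leaves the squared radial velocity.\<close>

lemma sqrt_Q:
  assumes "\<bar>\<theta>\<bar> \<le> 1/4" "adm c"
  shows "sqrt (2 * h + 2 * (cos \<theta> / L) - (c^2 - 2 * \<beta>) * (cos \<theta> / L)^2) = speed \<theta> * cos (att \<theta> c)"
proof (rule real_sqrt_unique)
  have "0 \<le> cos (att \<theta> c)" using cos_ge_small[OF att_bound[OF assms]] by simp
  then show "0 \<le> speed \<theta> * cos (att \<theta> c)" using speed_sq(3)[OF assms(1)] by simp
  have "c * cos \<theta> / L = speed \<theta> * sin (att \<theta> c)" using sin_att[OF assms] speed_sq(3)[OF assms(1)] L by simp
  then have "(speed \<theta>)^2 * (sin (att \<theta> c))^2 = (c * cos \<theta> / L)^2" by (simp add: power_mult_distrib)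
  then have "(speed \<theta> * cos (att \<theta> c))^2 = (speed \<theta>)^2 - (c * cos \<theta> / L)^2"
    by (simp add: power_mult_distrib cos_squared_eq algebra_simps)
  then show "(speed \<theta> * cos (att \<theta> c))^2 = 2 * h + 2 * (cos \<theta> / L) - (c^2 - 2 * \<beta>) * (cos \<theta> / L)^2"
    unfolding speed_sq(1)[OF assms(1)]
    by (simp add: power2_eq_square algebra_simps add_divide_distrib diff_divide_distrib)
qed

lemma vout_polar:
  assumes "\<bar>\<theta>\<bar> \<le> 1/4" "adm c"
  shows "Complex (speed \<theta> * cos (att \<theta> c)) (c * cos \<theta> / L) * cis (- pi/2 + \<theta>) = vout \<theta> c"
    "Complex (- (speed \<theta> * cos (att \<theta> c))) (c * cos \<theta> / L) * cis (- pi/2 + \<theta>) = vin \<theta> c"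
proof -
  have c: "c * cos \<theta> / L = speed \<theta> * sin (att \<theta> c)" using sin_att[OF assms] speed_sq(3)[OF assms(1)] L by simp
  have ci: "cis (- pi/2 + \<theta>) = Complex (sin \<theta>) (- cos \<theta>)"
    by (simp add: complex_eq_iff cos_diff sin_diff)
  show "Complex (speed \<theta> * cos (att \<theta> c)) (c * cos \<theta> / L) * cis (- pi/2 + \<theta>) = vout \<theta> c"
    "Complex (- (speed \<theta> * cos (att \<theta> c))) (c * cos \<theta> / L) * cis (- pi/2 + \<theta>) = vin \<theta> c"
    unfolding c ci vout_def vin_def by (simp_all add: complex_eq_iff sin_add cos_add sin_diff cos_diff algebra_simps)
qed

text \<open>Up to a positive factor the expression is the height above the wall at anomaly
  \<open>x\<close>. It vanishes at the wall anomaly and decreases before it: the rotation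
  contributes at most \<open>\<bar>c\<bar> * sqrt P\<close>, less than
  \<open>L * sqrt Q * sqrt P = L * ecc c * sin f\<close>, and the sine is smallest at
  \<open>f\<close> on that range. Both signs of \<open>m\<close> are allowed so as to treat both
  ends of an arc.\<close>

lemma wall_clearance:
  assumes c: "adm c" and t: "\<bar>\<theta>\<bar> \<le> 1/4" and m: "\<bar>m\<bar> = \<bar>c\<bar> / sqrt (c^2 - 2 * \<beta>)"
    and zero: "L * (1 + ecc c * cosf c \<theta>) + (c^2 - 2 * \<beta>) * sin (d + m * arccos (cosf c \<theta>)) = 0"
    and x: "pi / 2 \<le> x" "x < arccos (cosf c \<theta>)"
  shows "0 < L * (1 + ecc c * cos x) + (c^2 - 2 * \<beta>) * sin (d + m * x)"
proof -
  define f where "f = arccos (cosf c \<theta>)"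
  define P where "P = c^2 - 2 * \<beta>"
  define Q where "Q = 2 * h + 2 * (cos \<theta> / L) - (c^2 - 2 * \<beta>) * (cos \<theta> / L)^2"
  define K where "K x = L * (1 + ecc c * cos x) + P * sin (d + m * x)" for x
  have P: "0 < P" using c by (simp add: adm_def P_def)
  note cf = cosf_bounds[OF c t]
  have fpi: "f \<le> pi" unfolding f_def using cf by (intro arccos_ubound) auto
  have e: "0 < ecc c" using ecc_ge[OF c] by simp
  have sf: "sin f = sqrt P * sqrt Q / ecc c"
    using sqrt_cosf(1)[OF c t] cf by (simp add: f_def sin_arccos P_def Q_def)
  have cQ: "\<bar>c\<bar> < L * sqrt Q"
  proof (rule power2_less_imp_less)
    have Q: "1 / L \<le> Q" using sqrt_cosf(2)[OF c t] by (simp add: Q_def)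
    moreover have "0 < 1/L" using L by simp
    ultimately have Q0: "0 \<le> Q" by linarith
    have "L \<le> L * (L * Q)" using Q L by (simp add: field_simps)
    then have "L \<le> (L * sqrt Q)^2" using Q0 by (simp add: power_mult_distrib) (simp add: power2_eq_square)
    then show "\<bar>c\<bar>^2 < (L * sqrt Q)^2" using c L by (simp add: adm_def)
    show "0 \<le> L * sqrt Q" using L Q0 by simp
  qed
  have "K f < K x"
  proof (rule DERIV_neg_imp_decreasing[of x f K])
    show "x < f" using x by (simp add: f_def)
    fix y assume y: "x \<le> y" "y \<le> f"
    have "sin (pi - f) \<le> sin (pi - y)" using y x fpi by (intro sin_monotone_2pi_le) auto
    then have "sin f \<le> sin y" by simp
    then have 1: "L * (ecc c * sin f) \<le> L * (ecc c * sin y)" using L e by (intro mult_left_mono) auto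
    have "P * (m * cos (d + m * y)) \<le> P * \<bar>m\<bar>"
    proof (intro mult_left_mono)
      have "\<bar>m * cos (d + m * y)\<bar> \<le> \<bar>m\<bar> * 1" unfolding abs_mult by (intro mult_left_mono) auto
      then show "m * cos (d + m * y) \<le> \<bar>m\<bar>" by linarith
    qed (use P in auto)
    also have "P * \<bar>m\<bar> = \<bar>c\<bar> * sqrt P" unfolding m P_def[symmetric] using P
      by (simp add: field_simps real_div_sqrt)
    also have "\<dots> < L * sqrt Q * sqrt P" using cQ P by (intro mult_strict_right_mono) auto
    also have "\<dots> = L * (ecc c * sin f)" unfolding sf using e by simp
    finally have "P * (m * cos (d + m * y)) - L * (ecc c * sin y) < 0" using 1 by simp
    moreover have "(K has_real_derivative P * (m * cos (d + m * y)) - L * (ecc c * sin y)) (at y)"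
      unfolding K_def by (auto intro!: derivative_eq_intros)
    ultimately show "\<exists>D. (K has_real_derivative D) (at y) \<and> D < 0" by blast
  qed
  moreover have "K f = 0" using zero cf by (simp add: K_def f_def P_def)
  ultimately show ?thesis by (simp add: K_def P_def)
qed

text \<open>In polar coordinates \<open>r (1 + e cos f) = P\<close> is the Kepler conic with angular momentum
  \<open>sqrt P\<close>; the \<open>\<beta>\<close>-term only stretches the polar angle by the factor \<open>c / sqrt P\<close>.\<close>

lemma arc_exists:
  assumes c: "adm c" and t1: "\<bar>\<theta>1\<bar> \<le> 1/4" and t2: "\<bar>\<theta>2\<bar> \<le> 1/4"
    and eq: "\<Phi> c \<theta>1 \<theta>2 = 2 * pi * real_of_int k"
  shows "\<exists>T z z'. arc \<beta> L (pos \<theta>1) (vin \<theta>1 c) T z z' \<and> z T = pos \<theta>2 \<and> z' T = vout \<theta>2 c"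
proof -
  define P where "P = c^2 - 2 * \<beta>"
  define e where "e = ecc c"
  define l where "l = c / sqrt P"
  define f where "f \<theta> = arccos (cosf c \<theta>)" for \<theta>
  define w where "w x = 1 + e * cos x" for x
  \<comment> \<open>The time per unit of anomaly: \<open>r^2 * f' = sqrt P\<close> with
    \<open>r = P / w\<close>.\<close>
  define q where "q x = P * sqrt P / (w x)^2" for x
  \<comment> \<open>The polar angle of the pericenter, chosen so that anomaly
    \<open>- f \<theta>1\<close> points at the starting position.\<close>
  define d where "d = - pi/2 + \<theta>1 + l * f \<theta>1"
  have P: "0 < P" "P < L" using c L \<beta> by (auto simp: adm_def P_def)
  have sP: "sqrt P > 0" "sqrt P * sqrt P = P" using P by auto
  have e1: "1 \<le> e" unfolding e_def by (rule ecc_ge[OF c])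
  have f: "pi / 2 \<le> f \<theta>" "f \<theta> \<le> pi" "cos (f \<theta>) = cosf c \<theta>" "w (f \<theta>) = P * cos \<theta> / L"
      "sin (f \<theta>) = sqrt P * (speed \<theta> * cos (att \<theta> c)) / e" "0 < w (f \<theta>)"
      if t: "\<bar>\<theta>\<bar> \<le> 1/4" for \<theta>
  proof -
    note cf = cosf_bounds[OF c t]
    show "f \<theta> \<le> pi" unfolding f_def using cf by (intro arccos_ubound) auto
    have "arccos 0 \<le> f \<theta>" unfolding f_def using cf by (intro arccos_le_arccos) auto
    then show "pi / 2 \<le> f \<theta>" by simp
    show cos: "cos (f \<theta>) = cosf c \<theta>" unfolding f_def using cf by (intro cos_arccos) auto
    show w: "w (f \<theta>) = P * cos \<theta> / L" unfolding w_def cos using e1 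
      by (simp add: cosf_def e_def P_def)
    show "0 < w (f \<theta>)" unfolding w using P L cos_ge_small[OF t] by simp
    show "sin (f \<theta>) = sqrt P * (speed \<theta> * cos (att \<theta> c)) / e"
      using sqrt_cosf(1)[OF c t] cf sqrt_Q[OF t c] by (simp add: f_def sin_arccos P_def e_def)
  qed
  have wpos: "0 < w x" if x: "- f \<theta>1 \<le> x" "x \<le> f \<theta>2" for x
  proof -
    define F where "F = max (f \<theta>1) (f \<theta>2)"
    have F: "0 < w F" "F \<le> pi" using f[OF t1] f[OF t2] by (auto simp: F_def max_def)
    have "\<bar>x\<bar> \<le> F" using x f(1)[OF t1] f(1)[OF t2] pi_gt3 by (auto simp: F_def abs_le_iff max_def)
    then have "cos F \<le> cos \<bar>x\<bar>" using F by (intro cos_monotone_0_pi_le) auto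
    then have "w F \<le> w x" using e1 by (simp add: w_def)
    then show ?thesis using F by simp
  qed
  have "\<exists>T F. 0 < T \<and> F 0 = - f \<theta>1 \<and> F T = f \<theta>2 \<and> (\<forall>t\<in>{0<..<T}. - f \<theta>1 < F t \<and> F t < f \<theta>2) \<and>
    (\<forall>t\<in>{0..T}. (F has_real_derivative 1 / q (F t)) (at t))"
  proof (rule autonomous_solution)
    show "- f \<theta>1 < f \<theta>2" using f(1)[OF t1] f(1)[OF t2] pi_gt3 by linarith
    have "continuous_on {- f \<theta>1..f \<theta>2} w" unfolding w_def by (intro continuous_intros)
    moreover have "\<forall>x\<in>{- f \<theta>1..f \<theta>2}. (w x)^2 \<noteq> 0" using wpos by force
    ultimately show "continuous_on {- f \<theta>1..f \<theta>2} q" unfolding q_def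
      by (intro continuous_on_divide continuous_on_const continuous_on_power)
    show "0 < q x" if "x \<in> {- f \<theta>1..f \<theta>2}" for x using that wpos[of x] P by (simp add: q_def)
  qed
  then obtain T F where T: "0 < T" and F0: "F 0 = - f \<theta>1" and FT: "F T = f \<theta>2"
    and Fi: "\<And>t. t\<in>{0<..<T} \<Longrightarrow> - f \<theta>1 < F t \<and> F t < f \<theta>2"
    and dF: "\<And>t. t\<in>{0..T} \<Longrightarrow> (F has_real_derivative 1 / q (F t)) (at t)" by blast
  have FI: "- f \<theta>1 \<le> F t \<and> F t \<le> f \<theta>2" if "t \<in> {0..T}" for t
    using Fi[of t] that F0 FT f(1)[OF t1] f(1)[OF t2] pi_gt3 by (cases "t = 0"; cases "t = T") auto
  have wF: "0 < w (F t)" if "t \<in> {0..T}" for t using wpos FI[OF that] by auto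
  define R where "R t = P / w (F t)" for t
  define A where "A t = d + l * F t" for t
  define U where "U t = e * sin (F t) / sqrt P" for t
  define W where "W t = c * w (F t) / P" for t
  define z where "z t = Complex (R t) 0 * cis (A t)" for t
  define z' where "z' t = Complex (U t) (W t) * cis (A t)" for t
  have zd: "(z has_vector_derivative z' t) (at t)" and z'd: "(z' has_vector_derivative force \<beta> (z t)) (at t)"
    and z0: "z t \<noteq> 0" if t: "t \<in> {0..T}" for t
  proof -
    have w0: "0 < w (F t)" by (rule wF[OF t])
    define F' where "F' = (w (F t))^2 / (P * sqrt P)"
    have dF': "(F has_real_derivative F') (at t)" using dF[OF t] by (simp add: q_def F'_def)
    have dw: "((\<lambda>t. w (F t)) has_real_derivative - (e * sin (F t) * F')) (at t)"
      unfolding w_def using dF' by (auto intro!: derivative_eq_intros)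
    have R: "R t > 0" using w0 P by (simp add: R_def)
    have dA: "(A has_real_derivative l * F') (at t)" unfolding A_def using dF' by (auto intro!: derivative_eq_intros)
    have "(R has_real_derivative P * (e * sin (F t) * F') / (w (F t))^2) (at t)"
      unfolding R_def using dw w0 by (auto intro!: derivative_eq_intros simp: power2_eq_square)
    moreover have "P * (e * sin (F t) * F') / (w (F t))^2 = U t" using w0 P by (simp add: F'_def U_def)
    ultimately have dR: "(R has_real_derivative U t) (at t)" by simp
    have "R t * (l * F') = W t"
    proof -
      have "R t * (l * F') = P * c * (w (F t))^2 / (w (F t) * (sqrt P * sqrt P) * P)"
        by (simp add: R_def l_def F'_def)
      also have "\<dots> = W t" unfolding sP using w0 P by (simp add: W_def power2_eq_square)
      finally show ?thesis .
    qed
    then show "(z has_vector_derivative z' t) (at t)"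
      unfolding z_def z'_def using polar_derivative[OF dR DERIV_const[of 0] dA refl] by simp
    have dU: "(U has_real_derivative e * cos (F t) * F' / sqrt P) (at t)"
      unfolding U_def by (rule DERIV_cdivide) (auto intro!: derivative_eq_intros dF')
    have dW: "(W has_real_derivative - (c * (e * sin (F t) * F') / P)) (at t)"
      unfolding W_def using dw P by (auto intro!: derivative_eq_intros)
    \<comment> \<open>The transverse acceleration vanishes: angular momentum is conserved.\<close>
    have im: "- (c * (e * sin (F t) * F') / P) + U t * (l * F') = 0"
    proof -
      have "U t * (l * F') = c * (e * sin (F t) * F') / (sqrt P * sqrt P)" by (simp add: U_def l_def)
      then show ?thesis unfolding sP by simp
    qed
    \<comment> \<open>Inserting \<open>c^2 = P + 2 * \<beta>\<close> into the centrifugal term makes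
      the Kepler equation produce exactly the additional inverse-cube force.\<close>
    have re: "e * cos (F t) * F' / sqrt P - W t * (l * F') = - (1 / (R t)^3 + 2 * \<beta> / (R t)^4) * R t"
    proof -
      define y where "y = w (F t)"
      have ec: "e * cos (F t) = y - 1" by (simp add: y_def w_def)
      have "F' / sqrt P = y^2 / (P * (sqrt P * sqrt P))" by (simp only: F'_def y_def divide_divide_eq_left mult.assoc)
      then have Fs: "F' / sqrt P = y^2 / (P * P)" unfolding sP .
      have "e * cos (F t) * F' / sqrt P - W t * (l * F')
        = e * cos (F t) * (F' / sqrt P) - W t * (c * (F' / sqrt P))" by (simp add: l_def)
      also have "\<dots> = (y - 1) * (y^2 / (P * P)) - (c * y / P) * (c * (y^2 / (P * P)))"
        by (simp only: ec Fs W_def y_def)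
      also have "\<dots> = ((y - 1) * P - c^2 * y) * y^2 / P^3" using P(1)
        by (simp add: field_simps power2_eq_square power3_eq_cube)
      also have "(y - 1) * P - c^2 * y = - (P + 2 * \<beta> * y)" by (simp add: P_def algebra_simps)
      also have "- (P + 2 * \<beta> * y) * y^2 / P^3 = - (1 / (P/y)^3 + 2 * \<beta> / (P/y)^4) * (P / y)"
        using P(1) w0 unfolding y_def[symmetric] 
        by (simp add: field_simps power2_eq_square power3_eq_cube power4_eq_xxxx)
      finally show ?thesis by (simp add: R_def y_def)
    qed
    have "cmod (z t) = R t" unfolding z_def norm_mult norm_cis using R by (simp add: cmod_def)
    then have "force \<beta> (z t) = Complex (- (1 / (R t)^3 + 2 * \<beta> / (R t)^4) * R t) 0 * cis (A t)"
      by (simp add: force_def z_def complex_eq_iff)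
    then show "(z' has_vector_derivative force \<beta> (z t)) (at t)"
      using polar_derivative[OF dU dW dA refl] unfolding z'_def re im by simp
    have "Complex (R t) 0 \<noteq> 0" using R by (simp add: complex_eq_iff)
    then show "z t \<noteq> 0" unfolding z_def mult_eq_0_iff by simp
  qed
  have A0: "A 0 = - pi/2 + \<theta>1" by (simp add: A_def F0 d_def)
  \<comment> \<open>The winding equation makes the final polar angle correct up to \<open>k\<close>
    full turns.\<close>
  have AT: "cis (A T) = cis (- pi/2 + \<theta>2)"
  proof -
    have "l * f \<theta>1 + l * f \<theta>2 + \<theta>1 - \<theta>2 = 2 * pi * real_of_int k"
      using eq by (simp add: \<Phi>_def g_def l_def f_def P_def)
    then have "A T = (- pi/2 + \<theta>2) + 2 * pi * real_of_int k" unfolding A_def FT d_def by linarith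
    then show ?thesis by (simp only: cis_mult[symmetric] cis_multiple_2pi[OF Ints_of_int] mult_1_right)
  qed
  have r: "Complex (P / w (f \<theta>)) 0 * cis (- pi/2 + \<theta>) = pos \<theta>" if t: "\<bar>\<theta>\<bar> \<le> 1/4" for \<theta>
    unfolding f(4)[OF t] pos_def using P L cos_ge_small[OF t]
    by (simp add: complex_eq_iff cos_diff sin_diff tan_def)
  have wm: "w (- x) = w x" for x by (simp add: w_def)
  have zz: "z 0 = pos \<theta>1" "z T = pos \<theta>2"
    using r[OF t1] r[OF t2] by (simp_all add: z_def R_def F0 FT A0 AT wm)
  have v: "e * sin (f \<theta>) / sqrt P = speed \<theta> * cos (att \<theta> c)" "c * w (f \<theta>) / P = c * cos \<theta> / L"
    if t: "\<bar>\<theta>\<bar> \<le> 1/4" for \<theta>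
    unfolding f(4,5)[OF t] using P e1 by simp_all
  have zz': "z' 0 = vin \<theta>1 c" "z' T = vout \<theta>2 c"
    using v[OF t1] v[OF t2] vout_polar[OF t1 c] vout_polar[OF t2 c]
    by (simp_all add: z'_def U_def W_def F0 FT A0 AT wm)
  \<comment> \<open>The height above the wall multiplied by the positive \<open>w\<close>.\<close>
  define K where "K x = L * w x + P * sin (d + l * x)" for x
  have imz: "Im (z t) = (K (F t) - L * w (F t)) / w (F t)" if "t \<in> {0..T}" for t
    by (simp add: z_def R_def K_def A_def)
  have K0: "K (- f \<theta>1) = 0" "K (f \<theta>2) = 0"
    using imz[of 0] imz[of T] zz T F0 FT wF[of 0] wF[of T] by (simp_all add: pos_def field_simps)
  have Kpos: "0 < K x" if x: "- f \<theta>1 < x" "x < f \<theta>2" for x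
  proof -
    \<comment> \<open>Near either end \<open>wall_clearance\<close> applies, at the start with the
      direction of \<open>x\<close> reversed. In between \<open>w\<close> is at least 1, so the
      radius is at most \<open>P\<close>, which is below \<open>L\<close>.\<close>
    consider "pi / 2 \<le> x" | "pi / 2 \<le> - x" | "\<bar>x\<bar> \<le> pi / 2" by linarith
    then show ?thesis
    proof cases
      case 1
      have "0 < L * (1 + ecc c * cos x) + (c^2 - 2 * \<beta>) * sin (d + l * x)"
        using K0(2) f(3)[OF t2] x 1 P(1)
        by (intro wall_clearance[OF c t2]) (auto simp: l_def P_def K_def w_def e_def f_def abs_divide)
      then show ?thesis by (simp add: K_def w_def e_def P_def)
    next
      case 2
      have "0 < L * (1 + ecc c * cos (- x)) + (c^2 - 2 * \<beta>) * sin (d + (- l) * (- x))"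
        using K0(1) f(3)[OF t1] x 2 P(1)
        by (intro wall_clearance[OF c t1]) (auto simp: l_def P_def K_def w_def e_def f_def abs_divide)
      then show ?thesis by (simp add: K_def w_def e_def P_def)
    next
      case 3
      then have "0 \<le> cos x" by (intro cos_ge_zero) auto
      then have "L \<le> L * w x" using L e1 by (simp add: w_def)
      moreover have "P * (-1) \<le> P * sin (d + l * x)" using P by (intro mult_left_mono) auto
      ultimately show ?thesis using P unfolding K_def by linarith
    qed
  qed
  have "- L < Im (z t)" if t: "t \<in> {0<..<T}" for t
  proof -
    have t': "t \<in> {0..T}" using t by auto
    have "0 < K (F t) / w (F t)" using Kpos[of "F t"] Fi[OF t] wF[OF t'] by simp
    then show ?thesis unfolding imz[OF t'] using wF[OF t'] by (simp add: diff_divide_distrib)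
  qed
  moreover have "Im (z T) = - L" by (simp add: zz pos_def)
  ultimately have "arc \<beta> L (pos \<theta>1) (vin \<theta>1 c) T z z'"
    unfolding arc_def using T zz zz' zd z'd z0 by (auto intro: has_vector_derivative_at_within)
  then show ?thesis using zz zz' by blast
qed

lemma state_in_domain:
  assumes c: "adm c" and t1: "\<bar>\<theta>1\<bar> \<le> 1/4" and t2: "\<bar>\<theta>2\<bar> \<le> 1/4"
    and eq: "\<Phi> c \<theta>1 \<theta>2 = 2 * pi * real_of_int k"
  shows "(pos \<theta>1, vin \<theta>1 c) \<in> billiard_domain \<beta> L h"
proof -
  have "\<bar>att \<theta>1 c - \<theta>1\<bar> \<le> 1/2" using att_bound[OF t1 c] t1 by linarith
  then have "0 < cos (att \<theta>1 c - \<theta>1)" using pi_gt3 by (intro cos_gt_zero_pi) linarith+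
  then have im: "0 < Im (vin \<theta>1 c)" using speed_sq(3)[OF t1] by (simp add: vin_def)
  have co: "0 < cos \<theta>1" using cos_ge_small[OF t1] by simp
  have "cmod (pos \<theta>1) = L / cos \<theta>1"
  proof -
    have "(L * tan \<theta>1)^2 + (- L)^2 = (L / cos \<theta>1)^2"
      using co by (simp add: tan_def power_mult_distrib power_divide field_simps sin_squared_eq)
    then show ?thesis using L co by (simp add: pos_def cmod_def)
  qed
  then have V: "V \<beta> (pos \<theta>1) = - (cos \<theta>1 / L) - \<beta> * (cos \<theta>1 / L)^2"
    using L co by (simp add: V_def power_divide)
  have "(cmod (vin \<theta>1 c))^2 = (speed \<theta>1)^2"
    unfolding cmod_power2 vin_def by (simp add: power_mult_distrib) (metis distrib_left mult_1_right sin_cos_squared_add)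
  then have "(cmod (vin \<theta>1 c))^2 / 2 + V \<beta> (pos \<theta>1) = h"
    unfolding V speed_sq(1)[OF t1] by (simp add: field_simps)
  then show ?thesis using arc_exists[OF assms] im
    by (auto simp: billiard_domain_def pos_def)
qed

text \<open>Rearranged, \<open>refl\<close> says that the angle with the normal is preserved, which
  is elastic reflection of \<open>vout\<close> into \<open>vin\<close>.\<close>

lemma billiard_map_state:
  assumes c: "adm c" and t1: "\<bar>\<theta>1\<bar> \<le> 1/4" and t2: "\<bar>\<theta>2\<bar> \<le> 1/4"
    and eq: "\<Phi> c \<theta>1 \<theta>2 = 2 * pi * real_of_int k" and refl: "att \<theta>2 c' - att \<theta>2 c = 2 * \<theta>2"
  shows "billiard_map \<beta> L (pos \<theta>1, vin \<theta>1 c) = (pos \<theta>2, vin \<theta>2 c')"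
proof -
  obtain T z z' where a: "arc \<beta> L (pos \<theta>1) (vin \<theta>1 c) T z z'" "z T = pos \<theta>2" "z' T = vout \<theta>2 c"
    using arc_exists[OF c t1 t2 eq] by blast
  have e: "att \<theta>2 c + \<theta>2 = att \<theta>2 c' - \<theta>2" using refl by simp
  have "reflect (vout \<theta>2 c) = vin \<theta>2 c'"
    unfolding reflect_def vout_def vin_def by (simp only: e complex.sel minus_minus)
  then show ?thesis using billiard_map_eq[OF _ a(1)] \<beta> a by simp
qed

section \<open>Continuity of the coding\<close>

text \<open>Subtracting the two winding equations leaves a null sequence plus terms bounded through
  the box. The total is eventually below 2, hence below a full turn, so the integers agree. Then the
  contraction constant 1/2 gives \<open>\<bar>\<theta>' n - \<theta>0'\<bar> \<le> 2 * \<bar>s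
  n\<bar>\<close>.\<close>

lemma winding_continuous:
  assumes c: "c \<longlonglongrightarrow> c0" and t: "\<theta> \<longlonglongrightarrow> \<theta>0"
    and ad: "\<And>n. adm (c n)" "adm c0" and b: "\<bar>\<theta>0\<bar> \<le> 1/4" "\<And>n. \<bar>\<theta>' n\<bar> \<le> 1/4" "\<bar>\<theta>0'\<bar> \<le> 1/4"
    and eq: "\<And>n. \<Phi> (c n) (\<theta> n) (\<theta>' n) = 2 * pi * real_of_int (k n)" "\<Phi> c0 \<theta>0 \<theta>0' = 2 * pi * real_of_int k0"
  shows "\<theta>' \<longlonglongrightarrow> \<theta>0'" "\<forall>\<^sub>F n in sequentially. k n = k0"
proof -
  \<comment> \<open>Collects what does not involve \<open>\<theta>' n\<close>; convergence of
    \<open>\<theta>'\<close> is not yet known.\<close>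
  define s where "s n = (g (c n) (\<theta> n) + \<theta> n - (g c0 \<theta>0 + \<theta>0)) + (g (c n) \<theta>0' - g c0 \<theta>0')" for n
  have "s \<longlonglongrightarrow> (g c0 \<theta>0 + \<theta>0 - (g c0 \<theta>0 + \<theta>0)) + (g c0 \<theta>0' - g c0 \<theta>0')"
    unfolding s_def by (intro tendsto_intros tendsto_g c t ad b)
  then have s0: "s \<longlonglongrightarrow> 0" by simp
  have lip: "\<bar>g (c n) (\<theta>' n) - g (c n) \<theta>0'\<bar> \<le> 1/2 * \<bar>\<theta>' n - \<theta>0'\<bar>" for n
    using b by (intro g_lipschitz ad)
  have key: "2 * pi * real_of_int (k n - k0) = s n + (g (c n) (\<theta>' n) - g (c n) \<theta>0') - (\<theta>' n - \<theta>0')" for n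
    using eq(1)[of n] eq(2) by (simp add: \<Phi>_def s_def algebra_simps)
  have "\<forall>\<^sub>F n in sequentially. \<bar>s n\<bar> < 1"
    using tendstoD[OF s0, of 1] by (simp add: dist_real_def)
  then show k: "\<forall>\<^sub>F n in sequentially. k n = k0"
  proof eventually_elim
    case (elim n)
    have "\<bar>\<theta>' n - \<theta>0'\<bar> \<le> 1/2" using b(2)[of n] b(3) by linarith
    moreover from this have "\<bar>g (c n) (\<theta>' n) - g (c n) \<theta>0'\<bar> \<le> 1/4" using order_trans[OF lip[of n], of "1/4"] by simp
    ultimately have "\<bar>2 * pi * real_of_int (k n - k0)\<bar> < 2"
      unfolding key abs_less_iff abs_le_iff using elim[unfolded abs_less_iff] by linarith
    then have "2 * pi * \<bar>real_of_int (k n - k0)\<bar> < 2" by (simp add: abs_mult)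
    moreover have "2 * 3 * \<bar>real_of_int (k n - k0)\<bar> \<le> 2 * pi * \<bar>real_of_int (k n - k0)\<bar>"
      using pi_gt3 by (intro mult_right_mono) auto
    ultimately have "2 * 3 * \<bar>real_of_int (k n - k0)\<bar> < 2" by (rule le_less_trans[rotated])
    then have "real_of_int \<bar>k n - k0\<bar> < 1" by simp
    then show "k n = k0" unfolding of_int_less_1_iff by simp
  qed
  have "\<forall>\<^sub>F n in sequentially. \<bar>\<theta>' n - \<theta>0'\<bar> \<le> 2 * \<bar>s n\<bar>"
    using k
  proof eventually_elim
    case (elim n)
    then have "\<theta>' n - \<theta>0' = s n + (g (c n) (\<theta>' n) - g (c n) \<theta>0')" using key[of n] by simp
    moreover have "\<bar>x\<bar> \<le> 2 * \<bar>s\<bar>" if "x = s + y" "\<bar>y\<bar> \<le> 1/2 * \<bar>x\<bar>" for x s y :: real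
      using that by linarith
    ultimately show ?case using lip[of n] by blast
  qed
  moreover have "(\<lambda>n. 2 * \<bar>s n\<bar>) \<longlonglongrightarrow> 0" using tendsto_mult_right_zero[OF tendsto_rabs_zero[OF s0]] by simp
  ultimately have "(\<lambda>n. \<theta>' n - \<theta>0') \<longlonglongrightarrow> 0"
    by (intro Lim_null_comparison[of "\<lambda>n. \<theta>' n - \<theta>0'" "\<lambda>n. 2 * \<bar>s n\<bar>"]) simp_all
  then show "\<theta>' \<longlonglongrightarrow> \<theta>0'" by (simp add: LIM_zero_iff)
qed

lemma chain_D:
  assumes "chain \<theta> c k"
  shows "\<bar>\<theta> i\<bar> \<le> 1/4" "adm (c i)" "\<Phi> (c i) (\<theta> i) (\<theta> (i + 1)) = 2 * pi * real_of_int (k i)"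
    "att (\<theta> i) (c i) - att (\<theta> i) (c (i - 1)) = 2 * \<theta> i"
  using assms by (auto simp: chain_def)

text \<open>The winding equation fixes the limit of the next angle, after which the reflection law
  there determines the next angular momentum.\<close>

lemma chain_forward:
  assumes ch: "\<And>n. chain (\<theta> n) (c n) (k n)" "chain \<theta>0 c0 k0"
    and lim: "(\<lambda>n. \<theta> n i) \<longlonglongrightarrow> \<theta>0 i" "(\<lambda>n. c n i) \<longlonglongrightarrow> c0 i"
  shows "(\<lambda>n. \<theta> n (i + 1)) \<longlonglongrightarrow> \<theta>0 (i + 1)" "(\<lambda>n. c n (i + 1)) \<longlonglongrightarrow> c0 (i + 1)"
    "\<forall>\<^sub>F n in sequentially. k n i = k0 i"
proof -
  note D = chain_D[OF ch(1)] chain_D[OF ch(2)]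
  show th: "(\<lambda>n. \<theta> n (i + 1)) \<longlonglongrightarrow> \<theta>0 (i + 1)" and "\<forall>\<^sub>F n in sequentially. k n i = k0 i"
    using winding_continuous[OF lim(2,1), of "\<lambda>n. \<theta> n (i + 1)" "\<theta>0 (i + 1)" "\<lambda>n. k n i" "k0 i"] D by auto
  have e: "c i' = L * speed (\<theta> i') / cos (\<theta> i') * sin (att (\<theta> i') (c (i' - 1)) + 2 * \<theta> i')"
    if "chain \<theta> c k" for \<theta> c k i'
    using angmom_att[OF chain_D(1,2)[OF that, of i']] chain_D(4)[OF that, of i'] by (simp add: algebra_simps)
  have "cos (\<theta>0 (i + 1)) \<noteq> 0" using cos_ge_small[OF D(5), of "i + 1"] by auto
  then have "(\<lambda>n. L * speed (\<theta> n (i + 1)) / cos (\<theta> n (i + 1)) * sin (att (\<theta> n (i + 1)) (c n i) + 2 * \<theta> n (i + 1)))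
    \<longlonglongrightarrow> L * speed (\<theta>0 (i + 1)) / cos (\<theta>0 (i + 1)) * sin (att (\<theta>0 (i + 1)) (c0 i) + 2 * \<theta>0 (i + 1))"
    by (intro tendsto_intros isCont_tendsto_compose[OF isCont_cos] isCont_tendsto_compose[OF isCont_sin]
        tendsto_speed tendsto_att th lim D)
  then show "(\<lambda>n. c n (i + 1)) \<longlonglongrightarrow> c0 (i + 1)"
    using e[OF ch(1), of _ "i + 1"] e[OF ch(2), of "i + 1"] by simp
qed

text \<open>The order is reversed: the reflection law at \<open>i + 1\<close> first yields
  \<open>c i\<close>, then the arc is traversed backwards.\<close>

lemma chain_backward:
  assumes ch: "\<And>n. chain (\<theta> n) (c n) (k n)" "chain \<theta>0 c0 k0"
    and lim: "(\<lambda>n. \<theta> n (i + 1)) \<longlonglongrightarrow> \<theta>0 (i + 1)" "(\<lambda>n. c n (i + 1)) \<longlonglongrightarrow> c0 (i + 1)"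
  shows "(\<lambda>n. \<theta> n i) \<longlonglongrightarrow> \<theta>0 i" "(\<lambda>n. c n i) \<longlonglongrightarrow> c0 i"
proof -
  note D = chain_D[OF ch(1)] chain_D[OF ch(2)]
  have e: "c (i' - 1) = L * speed (\<theta> i') / cos (\<theta> i') * sin (att (\<theta> i') (c i') - 2 * \<theta> i')"
    if "chain \<theta> c k" for \<theta> c k i'
    using angmom_att[OF chain_D(1)[OF that, of i'] chain_D(2)[OF that, of "i' - 1"]] chain_D(4)[OF that, of i'] by (simp add: algebra_simps)
  have "cos (\<theta>0 (i + 1)) \<noteq> 0" using cos_ge_small[OF D(5), of "i + 1"] by auto
  then have "(\<lambda>n. L * speed (\<theta> n (i + 1)) / cos (\<theta> n (i + 1)) * sin (att (\<theta> n (i + 1)) (c n (i + 1)) - 2 * \<theta> n (i + 1)))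
    \<longlonglongrightarrow> L * speed (\<theta>0 (i + 1)) / cos (\<theta>0 (i + 1)) * sin (att (\<theta>0 (i + 1)) (c0 (i + 1)) - 2 * \<theta>0 (i + 1))"
    by (intro tendsto_intros isCont_tendsto_compose[OF isCont_cos] isCont_tendsto_compose[OF isCont_sin]
        tendsto_speed tendsto_att lim D)
  then show c: "(\<lambda>n. c n i) \<longlonglongrightarrow> c0 i"
    using e[OF ch(1), of _ "i + 1"] e[OF ch(2), of "i + 1"] by simp
  \<comment> \<open>By the second symmetry in \<open>\<Phi>_minus\<close>, the negated and exchanged
    end points satisfy the same winding equation.\<close>
  have "(\<lambda>n. - \<theta> n i) \<longlonglongrightarrow> - \<theta>0 i"
    using winding_continuous[OF c tendsto_minus[OF lim(1)], of "\<lambda>n. - \<theta> n i" "- \<theta>0 i" "\<lambda>n. k n i" "k0 i"] D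
    by (simp add: \<Phi>_minus)
  then show "(\<lambda>n. \<theta> n i) \<longlonglongrightarrow> \<theta>0 i" by (simp add: tendsto_minus_cancel_left)
qed

lemma chain_continuous:
  assumes ch: "\<And>n. chain (\<theta> n) (c n) (k n)" "chain \<theta>0 c0 k0"
    and lim: "(\<lambda>n. \<theta> n 0) \<longlonglongrightarrow> \<theta>0 0" "(\<lambda>n. c n 0) \<longlonglongrightarrow> c0 0"
  shows "\<forall>\<^sub>F n in sequentially. k n i = k0 i"
proof -
  have "(\<lambda>n. \<theta> n i) \<longlonglongrightarrow> \<theta>0 i \<and> (\<lambda>n. c n i) \<longlonglongrightarrow> c0 i"
  proof (induction i rule: int_induct[where k = 0])
    case base then show ?case using lim by simp
  next
    case (step1 i) then show ?case using chain_forward(1,2)[of \<theta> c k \<theta>0 c0 k0 i, OF ch] by blast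
  next
    case (step2 i) then show ?case using chain_backward[of \<theta> c k \<theta>0 c0 k0 "i - 1", OF ch] by simp
  qed
  then show ?thesis using chain_forward(3)[of \<theta> c k \<theta>0 c0 k0 i, OF ch] by blast
qed

text \<open>Continuity applied to a constant sequence of chains.\<close>

lemma chain_unique:
  assumes "chain \<theta> c k" "chain \<theta>' c' k'" "\<theta> 0 = \<theta>' 0" "c 0 = c' 0"
  shows "k = k'"
proof
  fix i
  have "\<forall>\<^sub>F n in sequentially. k i = k' i"
    using chain_continuous[of "\<lambda>_. \<theta>" "\<lambda>_. c" "\<lambda>_. k" \<theta>' c' k' i] assms by simp
  then show "k i = k' i" by simp
qed

lemma chain_shift:
  assumes "chain \<theta> c k" shows "chain (\<lambda>i. \<theta> (i + 1)) (\<lambda>i. c (i + 1)) (shift k)"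
  using assms unfolding chain_def shift_def by (metis add.commute add_diff_cancel_left' diff_add_cancel)

section \<open>The coding map and the semiconjugacy\<close>

definition state :: "real \<Rightarrow> real \<Rightarrow> complex \<times> complex" where "state \<theta> c = (pos \<theta>, vin \<theta> c)"

text \<open>With \<open>angmom_of\<close>, the cross product of position and velocity, this inverts
  \<open>state\<close> on the box. Both are continuous formulas on all of phase space, so
  convergence of states passes to the coordinates.\<close>

definition angle_of :: "complex \<times> complex \<Rightarrow> real" where "angle_of x = arctan (Re (fst x) / L)"

definition angmom_of :: "complex \<times> complex \<Rightarrow> real" where
  "angmom_of x = Re (fst x) * Im (snd x) - Im (fst x) * Re (snd x)"

lemma angle_of_state: "\<bar>\<theta>\<bar> \<le> 1/4 \<Longrightarrow> angle_of (state \<theta> c) = \<theta>"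
  using L pi_gt3 by (simp add: angle_of_def state_def pos_def arctan_tan)

lemma angmom_of_state:
  assumes "\<bar>\<theta>\<bar> \<le> 1/4" "adm c" shows "angmom_of (state \<theta> c) = c"
proof -
  have co: "0 < cos \<theta>" using cos_ge_small[OF assms(1)] by simp
  have "angmom_of (state \<theta> c) = L * speed \<theta> / cos \<theta> *
      (sin \<theta> * cos (att \<theta> c - \<theta>) + cos \<theta> * sin (att \<theta> c - \<theta>))"
    using co by (simp add: angmom_of_def state_def pos_def vin_def tan_def field_simps)
  also have "sin \<theta> * cos (att \<theta> c - \<theta>) + cos \<theta> * sin (att \<theta> c - \<theta>) = sin (att \<theta> c)"
    using sin_add[of \<theta> "att \<theta> c - \<theta>"] by simp
  finally show ?thesis using angmom_att[OF assms] by simp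
qed

lemma tendsto_angle_of: "y \<longlonglongrightarrow> x \<Longrightarrow> (\<lambda>n. angle_of (y n)) \<longlonglongrightarrow> angle_of x"
  unfolding angle_of_def using L by (intro tendsto_intros) auto

lemma tendsto_angmom_of: "y \<longlonglongrightarrow> x \<Longrightarrow> (\<lambda>n. angmom_of (y n)) \<longlonglongrightarrow> angmom_of x"
  unfolding angmom_of_def by (intro tendsto_intros)

text \<open>The invariant set consists of all points with a code. A code is unique for its point,
  but several points may share one, whence only a semiconjugacy.\<close>

definition codes :: "complex \<times> complex \<Rightarrow> (int \<Rightarrow> int) \<Rightarrow> bool" where
  "codes x k \<longleftrightarrow> k \<in> Omega \<and> (\<exists>\<theta> c. chain \<theta> c k \<and> x = state (\<theta> 0) (c 0))"

lemma codes_unique: "codes x k \<Longrightarrow> codes x k' \<Longrightarrow> k = k'"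
  unfolding codes_def by (metis angle_of_state angmom_of_state chain_D(1,2) chain_unique)

lemma codes_exists: "k \<in> Omega \<Longrightarrow> \<exists>x. codes x k"
  using chain_exists[of k] unfolding codes_def Omega_def by blast

lemma codes_domain: "codes x k \<Longrightarrow> x \<in> billiard_domain \<beta> L h"
  unfolding codes_def state_def by (auto intro: state_in_domain chain_D)

lemma codes_billiard_map:
  assumes "codes x k" shows "codes (billiard_map \<beta> L x) (shift k)"
proof -
  obtain \<theta> c where ch: "chain \<theta> c k" "x = state (\<theta> 0) (c 0)" and k: "k \<in> Omega"
    using assms by (auto simp: codes_def)
  have "billiard_map \<beta> L x = state (\<theta> 1) (c 1)"
    unfolding ch(2) state_def using chain_D(3)[OF ch(1), of 0] chain_D(4)[OF ch(1), of 1]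
    by (intro billiard_map_state[where k = "k 0"] chain_D[OF ch(1)]) simp_all
  moreover have "shift k \<in> Omega" using k by (simp add: Omega_def shift_def)
  ultimately show ?thesis unfolding codes_def using chain_shift[OF ch(1)]
    by (intro conjI exI[of _ "\<lambda>i. \<theta> (i + 1)"] exI[of _ "\<lambda>i. c (i + 1)"]) simp_all
qed

lemma codes_continuous:
  assumes lim: "y \<longlonglongrightarrow> x" and y: "\<And>n. codes (y n) (k n)" and x: "codes x k0"
    and lam: "1 < lam" and \<epsilon>: "0 < \<epsilon>"
  shows "\<forall>\<^sub>F n in sequentially. omega_dist lam k0 (k n) < \<epsilon>"
proof -
  obtain \<theta> c where ch: "\<And>n. chain (\<theta> n) (c n) (k n)" and yn: "\<And>n. y n = state (\<theta> n 0) (c n 0)"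
    using y unfolding codes_def by metis
  obtain \<theta>0 c0 where ch0: "chain \<theta>0 c0 k0" and x0: "x = state (\<theta>0 0) (c0 0)"
    using x unfolding codes_def by metis
  have "(\<lambda>n. \<theta> n 0) \<longlonglongrightarrow> \<theta>0 0"
    using tendsto_angle_of[OF lim] unfolding yn x0 using chain_D[OF ch] chain_D[OF ch0]
    by (simp add: angle_of_state)
  moreover have "(\<lambda>n. c n 0) \<longlonglongrightarrow> c0 0"
    using tendsto_angmom_of[OF lim] unfolding yn x0 using chain_D[OF ch] chain_D[OF ch0]
    by (simp add: angmom_of_state)
  ultimately have ev: "\<forall>\<^sub>F n in sequentially. k n i = k0 i" for i
    by (rule chain_continuous[OF ch ch0])
  obtain N where N: "\<And>s s'. (\<And>i. \<bar>i\<bar> \<le> N \<Longrightarrow> s i = s' i) \<Longrightarrow> omega_dist lam s s' < \<epsilon>"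
    using omega_dist_small[OF lam \<epsilon>] by blast
  have "\<forall>\<^sub>F n in sequentially. \<forall>i\<in>{-N..N}. k n i = k0 i"
    using ev by (intro eventually_ball_finite) auto
  then show ?thesis by eventually_elim (auto intro!: N simp: abs_le_iff)
qed

lemma semiconjugacy:
  assumes lam: "1 < lam"
  shows "\<exists>X' \<pi>. X' \<subseteq> billiard_domain \<beta> L h \<and>
       billiard_map \<beta> L ` X' \<subseteq> X' \<and>
       \<pi> ` X' = Omega \<and>
       (\<forall>x\<in>X'. \<forall>\<epsilon>>0. \<exists>\<delta>>0. \<forall>y\<in>X'. dist x y < \<delta> \<longrightarrow> omega_dist lam (\<pi> x) (\<pi> y) < \<epsilon>) \<and>
       (\<forall>x\<in>X'. shift (\<pi> x) = \<pi> (billiard_map \<beta> L x))"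
proof -
  define X' where "X' = {x. \<exists>k. codes x k}"
  define \<pi> where "\<pi> x = (THE k. codes x k)" for x
  have \<pi>: "\<pi> x = k" if "codes x k" for x k
    unfolding \<pi>_def using that codes_unique by (intro the_equality)
  have codes: "codes x (\<pi> x)" if x: "x \<in> X'" for x
  proof -
    obtain k where "codes x k" using x by (auto simp: X'_def)
    then show ?thesis using \<pi>[of x k] by simp
  qed
  have "\<exists>\<delta>>0. \<forall>y\<in>X'. dist x y < \<delta> \<longrightarrow> omega_dist lam (\<pi> x) (\<pi> y) < \<epsilon>" if x: "x \<in> X'" and \<epsilon>: "\<epsilon> > 0" for x \<epsilon>
  proof (rule ccontr)
    \<comment> \<open>Failure of continuity gives points \<open>y n\<close> within
      \<open>1 / (n + 1)\<close> of \<open>x\<close> whose codes stay away from that of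
      \<open>x\<close>.\<close>
    assume "\<not> ?thesis"
    then have "\<exists>y\<in>X'. dist x y < inverse (real (Suc n)) \<and> \<not> omega_dist lam (\<pi> x) (\<pi> y) < \<epsilon>" for n
      by (metis inverse_positive_iff_positive of_nat_0_less_iff zero_less_Suc)
    then obtain y where y: "\<And>n. y n \<in> X'" "\<And>n. dist x (y n) < inverse (real (Suc n))"
      "\<And>n. \<not> omega_dist lam (\<pi> x) (\<pi> (y n)) < \<epsilon>" by metis
    have "norm (dist (y n) x) \<le> inverse (real (Suc n))" for n
      using y(2)[of n] by (simp add: dist_commute)
    then have "(\<lambda>n. dist (y n) x) \<longlonglongrightarrow> 0"
      by (intro Lim_null_comparison[OF _ LIMSEQ_inverse_real_of_nat] always_eventually allI)
    then have "y \<longlonglongrightarrow> x" by (simp only: tendsto_dist_iff[symmetric])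
    then have "\<forall>\<^sub>F n in sequentially. omega_dist lam (\<pi> x) (\<pi> (y n)) < \<epsilon>"
      using codes[OF y(1)] codes[OF x] lam \<epsilon> by (rule codes_continuous)
    then show False using y(3) by simp
  qed
  moreover have "\<pi> ` X' = Omega"
  proof (intro equalityI subsetI)
    fix k assume "k \<in> \<pi> ` X'"
    then show "k \<in> Omega" using codes by (auto simp: codes_def)
  next
    fix k assume "k \<in> Omega"
    then obtain x where "codes x k" using codes_exists by blast
    then show "k \<in> \<pi> ` X'" using \<pi>[of x k] by (intro image_eqI[of _ _ x]) (auto simp: X'_def)
  qed
  moreover have "X' \<subseteq> billiard_domain \<beta> L h" using codes_domain by (auto simp: X'_def)
  moreover have "billiard_map \<beta> L ` X' \<subseteq> X'" unfolding X'_def using codes_billiard_map by blast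
  moreover have "\<forall>x\<in>X'. shift (\<pi> x) = \<pi> (billiard_map \<beta> L x)"
    using \<pi>[OF codes_billiard_map[OF codes]] by simp
  ultimately show ?thesis by blast
qed

end

theorem theorem1p2:
  fixes L h lam :: real
  assumes "L > 0" and "h > 0" and "lam > 3"
  shows "\<exists>\<beta>0>0. \<forall>\<beta>. 0 < \<beta> \<and> \<beta> < \<beta>0 \<longrightarrow>
    (\<exists>X' \<pi>. X' \<subseteq> billiard_domain \<beta> L h \<and>
       billiard_map \<beta> L ` X' \<subseteq> X' \<and>
       \<pi> ` X' = Omega \<and>
       (\<forall>x\<in>X'. \<forall>\<epsilon>>0. \<exists>\<delta>>0. \<forall>y\<in>X'. dist x y < \<delta> \<longrightarrow> omega_dist lam (\<pi> x) (\<pi> y) < \<epsilon>) \<and>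
       (\<forall>x\<in>X'. shift (\<pi> x) = \<pi> (billiard_map \<beta> L x)))"
\<comment> \<open>The threshold depends on \<open>L\<close> only: the estimates involving
  \<open>h\<close> need just its positivity.\<close>
proof (intro exI[of _ "L / 1600"] conjI allI impI)
  fix \<beta> assume "0 < \<beta> \<and> \<beta> < L / 1600"
  then interpret boltzmann L h \<beta> using assms by unfold_locales auto
  show "\<exists>X' \<pi>. X' \<subseteq> billiard_domain \<beta> L h \<and>
       billiard_map \<beta> L ` X' \<subseteq> X' \<and>
       \<pi> ` X' = Omega \<and>
       (\<forall>x\<in>X'. \<forall>\<epsilon>>0. \<exists>\<delta>>0. \<forall>y\<in>X'. dist x y < \<delta> \<longrightarrow> omega_dist lam (\<pi> x) (\<pi> y) < \<epsilon>) \<and>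
       (\<forall>x\<in>X'. shift (\<pi> x) = \<pi> (billiard_map \<beta> L x))"
    using assms by (intro semiconjugacy) auto
qed (use assms in auto)

end
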